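(* Let $T=(T_1,\ldots,T_d)$ be a pure cyclic row contraction on some Hilbert space $\mathfrak{H}$. Then there is a contractive operator $X:\mathfrak{F}_d^2\to\mathfrak{H}$ with dense range such that $XL_k=T_kX$ for $k=1,\dots,d$. If $T$ is commuting, then there is a contractive operator $X':H^2_d\to\mathfrak{H}$ with dense range such that $X'M_{x_k}=T_kX'$ for $k=1,\dots,d$.
   Context: Fix a positive integer $d$. $\mathfrak{F}^2_d=\mathbb{C}\Omega\oplus\bigoplus_{n\ge1}(\mathbb{C}^d)^{\otimes n}$ is the full Fock space over $\mathbb{C}^d$ ($\Omega$ a unit vector, $\{e_1,\dots,e_d\}$ an orthonormal basis of $\mathbb{C}^d$), and $L_k:\mathfrak{F}^2_d\to\mathfrak{F}^2_d$ is the left creation operator $L_kv=e_k\otimes v$ (with $L_k\Omega=e_k$). The Drury--Arveson space $H^2_d$ is the Hilbert space of analytic functions $f=\sum_{\alpha\in\mathbb{N}^d}c_\alpha x^\alpha$ on the open unit ball $\mathbb{B}_d\subset\mathbb{C}^d$ with $\|f\|^2=\sum_{\alpha}\frac{\alpha!}{|\alpha|!}|c_\alpha|^2<\infty$, and $M_{x_k}$ is multiplication by the $k$-th coordinate function on $H^2_d$. A $d$-tuple $T=(T_1,\dots,T_d)$ of bounded operators on $\mathfrak{H}$ is a row contraction if $\sum_{k=1}^d T_kT_k^*\le I$ (no commutation assumed); it is commuting if the $T_k$ commute with each other; it is pure if $\lim_{n\to\infty}\sum_{|w|=n}\|T_w^*\xi\|^2=0$ for all $\xi\in\mathfrak{H}$,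 where $w=i_1\cdots i_n$ ranges over words of length $n$ in $\{1,\dots,d\}$ and $T_w=T_{i_1}\cdots T_{i_n}$. $T$ is cyclic if there is a vector $\xi$ such that $\mathfrak{H}$ is the closed linear span of $\{T_w\xi\}$ over all words $w$ (including the empty word). *)

theory Defs
  imports "HOL-Analysis.Analysis"
begin

section \<open>Complex Hilbert spaces\<close>

text \<open>
  The inner product is linear in the first argument.  The underlying real inner product
  is required to be its real part, so that norm, distance and topology are those
  of \<^class>\<open>real_inner\<close>.
\<close>

class complex_inner = real_inner +
  fixes scaleC :: "complex \<Rightarrow> 'a \<Rightarrow> 'a"  (infixr "*\<^sub>C" 75)
    and cinner :: "'a \<Rightarrow> 'a \<Rightarrow> complex"
  assumes scaleC_add_right: "a *\<^sub>C (x + y) = a *\<^sub>C x + a *\<^sub>C y"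
    and scaleC_add_left: "(a + b) *\<^sub>C x = a *\<^sub>C x + b *\<^sub>C x"
    and scaleC_scaleC: "a *\<^sub>C (b *\<^sub>C x) = (a * b) *\<^sub>C x"
    and scaleC_one: "1 *\<^sub>C x = x"
    and scaleR_scaleC: "scaleR r x = complex_of_real r *\<^sub>C x"
    and cinner_commute: "cinner x y = cnj (cinner y x)"
    and cinner_add_left: "cinner (x + y) z = cinner x z + cinner y z"
    and cinner_scaleC_left: "cinner (a *\<^sub>C x) y = a * cinner x y"
    and inner_eq_Re_cinner: "inner x y = Re (cinner x y)"

class chilbert_space = complex_inner + complete_space

interpretation complex_vector: vector_space "scaleC :: complex \<Rightarrow> 'a \<Rightarrow> 'a::complex_inner"
  by unfold_locales (simp_all add: scaleC_add_right scaleC_add_left scaleC_scaleC scaleC_one)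

definition cspan :: "'a::complex_inner set \<Rightarrow> 'a set"
  where "cspan = module.span scaleC"

definition bounded_clinear :: "('a::complex_inner \<Rightarrow> 'b::complex_inner) \<Rightarrow> bool"
  where "bounded_clinear A \<longleftrightarrow> bounded_linear A \<and> (\<forall>c x. A (c *\<^sub>C x) = c *\<^sub>C A x)"

definition contractive :: "('a::complex_inner \<Rightarrow> 'b::complex_inner) \<Rightarrow> bool"
  where "contractive A \<longleftrightarrow> bounded_clinear A \<and> onorm A \<le> 1"

definition dense_range :: "('a \<Rightarrow> 'b::topological_space) \<Rightarrow> bool"
  where "dense_range A \<longleftrightarrow> closure (range A) = UNIV"

definition cadjoint :: "('a::complex_inner \<Rightarrow> 'b::complex_inner) \<Rightarrow> 'b \<Rightarrow> 'a"
  where "cadjoint A = (THE B. \<forall>x y. cinner (A x) y = cinner x (B y))"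

definition op_le :: "('a::complex_inner \<Rightarrow> 'a) \<Rightarrow> ('a \<Rightarrow> 'a) \<Rightarrow> bool"
  where "op_le A B \<longleftrightarrow> (\<forall>x. cinner (B x - A x) x \<in> \<real>\<^sub>\<ge>\<^sub>0)"


subsection \<open>Existence of adjoints\<close>

lemma real_riesz:
  fixes g :: "'a::{real_inner,complete_space} \<Rightarrow> real"
  assumes "bounded_linear g"
  shows "\<exists>u. \<forall>x. g x = inner x u"
proof -
  interpret g: bounded_linear g by fact
  define J where "J x = (norm x)\<^sup>2 - 2 * g x" for x
  obtain K where K: "\<And>x. \<bar>g x\<bar> \<le> norm x * K" using g.bounded by auto
  have lower: "- K\<^sup>2 \<le> J x" for x
  proof -
    have "0 \<le> (norm x - K)\<^sup>2" by simp
    then have "2 * (norm x * K) \<le> (norm x)\<^sup>2 + K\<^sup>2" by (simp add: power2_diff mult.assoc)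
    with K[of x] show ?thesis unfolding J_def by linarith
  qed
  define m where "m = Inf (range J)"
  have bdd: "bdd_below (range J)" using lower by (auto intro!: bdd_belowI)
  have m_le: "m \<le> J x" for x unfolding m_def by (rule cInf_lower[OF _ bdd]) simp
  have "\<exists>x. J x < m + inverse (real (Suc n))" for n
  proof -
    have "Inf (range J) < m + inverse (real (Suc n))" unfolding m_def by simp
    then show ?thesis using cInf_less_iff[of "range J"] bdd by auto
  qed
  then obtain X where X: "\<And>n. J (X n) < m + inverse (real (Suc n))" by metis
  have par: "(dist x y)\<^sup>2 = 2 * J x + 2 * J y - 4 * J ((1/2) *\<^sub>R (x + y))" for x y
  proof -
    have "(norm ((1/2) *\<^sub>R (x + y)))\<^sup>2 = (norm (x + y))\<^sup>2 / 4"
      by (simp only: norm_scaleR power_mult_distrib) (simp add: power2_eq_square)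
    moreover have "(norm (x + y))\<^sup>2 + (norm (x - y))\<^sup>2 = 2 * (norm x)\<^sup>2 + 2 * (norm y)\<^sup>2"
      by (simp add: power2_norm_eq_inner inner_add inner_diff algebra_simps)
    ultimately show ?thesis
      by (simp add: J_def dist_norm g.scaleR g.add algebra_simps)
  qed
  have dX: "(dist (X i) (X j))\<^sup>2 \<le> 2 * inverse (real (Suc i)) + 2 * inverse (real (Suc j))" for i j
    using par[of "X i" "X j"] X[of i] X[of j] m_le[of "(1/2) *\<^sub>R (X i + X j)"] by linarith
  have "Cauchy X"
  proof (rule metric_CauchyI)
    fix e :: real assume e: "0 < e"
    then obtain N where N: "inverse (real (Suc N)) < e\<^sup>2 / 4"
      using reals_Archimedean[of "e\<^sup>2/4"] by auto
    have "dist (X i) (X j) < e" if "i \<ge> N" "j \<ge> N" for i j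
    proof -
      have "inverse (real (Suc i)) \<le> inverse (real (Suc N))"
        "inverse (real (Suc j)) \<le> inverse (real (Suc N))" using that by (auto intro!: le_imp_inverse_le)
      with dX[of i j] N have "(dist (X i) (X j))\<^sup>2 < e\<^sup>2" by linarith
      then show ?thesis using e by (simp add: power2_less_imp_less)
    qed
    then show "\<exists>M. \<forall>m\<ge>M. \<forall>n\<ge>M. dist (X m) (X n) < e" by blast
  qed
  then obtain u where u: "X \<longlonglongrightarrow> u" using Cauchy_convergent convergent_def by blast
  have "(\<lambda>n. J (X n)) \<longlonglongrightarrow> J u"
    unfolding J_def by (intro tendsto_intros u g.tendsto)
  moreover have "(\<lambda>n. m + inverse (real (Suc n))) \<longlonglongrightarrow> m + 0"
    by (intro tendsto_intros LIMSEQ_inverse_real_of_nat)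
  ultimately have Ju: "J u \<le> m"
    using LIMSEQ_le[of "\<lambda>n. J (X n)" "J u" "\<lambda>n. m + inverse (real (Suc n))" "m + 0"] X
    by (force intro: less_imp_le)
  have "g x = inner x u" for x
  proof -
    define d where "d = inner x u - g x"
    have pos: "0 \<le> t\<^sup>2 * (norm x)\<^sup>2 + 2 * t * d" for t
    proof -
      have "J (u + t *\<^sub>R x) = J u + t\<^sup>2 * (norm x)\<^sup>2 + 2 * t * d"
        unfolding J_def d_def power2_norm_eq_inner
        by (simp add: g.add g.scaleR inner_add_left inner_add_right inner_commute[of u x]
            distrib_left right_diff_distrib power2_eq_square)
      with m_le[of "u + t *\<^sub>R x"] Ju show ?thesis by linarith
    qed
    have "d = 0"
    proof (rule ccontr)
      assume "d \<noteq> 0"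
      define s where "s = (norm x)\<^sup>2 + 1"
      have s: "s > 0" unfolding s_def by (smt (verit) zero_le_power2)
      have "0 \<le> (d/s)\<^sup>2 * (norm x)\<^sup>2 + 2 * (- d/s) * d" using pos[of "- d/s"] by simp
      also have "\<dots> = (d/s)\<^sup>2 * ((norm x)\<^sup>2 - 2 * s)" using s by (simp add: field_simps power2_eq_square)
      also have "\<dots> < 0" using s \<open>d \<noteq> 0\<close> by (intro mult_pos_neg) (auto simp: s_def)
      finally show False by simp
    qed
    then show ?thesis by (simp add: d_def)
  qed
  then show ?thesis by blast
qed

lemma cinner_eq_inner:
  "cinner x y = Complex (inner x y) (inner ((- \<i>) *\<^sub>C x) y)"
  unfolding inner_eq_Re_cinner cinner_scaleC_left by (simp add: complex_eq_iff)

lemma cadjoint_eqI: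
  fixes A :: "'a::complex_inner \<Rightarrow> 'b::complex_inner"
  assumes "\<And>x y. cinner (A x) y = cinner x (B y)"
  shows "cadjoint A = B"
  unfolding cadjoint_def
proof (rule the_equality)
  fix C assume C: "\<forall>x y. cinner (A x) y = cinner x (C y)"
  have "inner x (C y) = inner x (B y)" for x y
    using C assms[of x y] by (simp add: inner_eq_Re_cinner)
  then show "C = B" by (intro ext) (metis inner_commute vector_eq_rdot)
qed (use assms in blast)

lemma cinner_cadjoint:
  fixes A :: "'a::chilbert_space \<Rightarrow> 'b::complex_inner"
  assumes "bounded_clinear A"
  shows "cinner (A x) y = cinner x (cadjoint A y)"
proof -
  have A: "bounded_linear A" "\<And>c x. A (c *\<^sub>C x) = c *\<^sub>C A x"
    using assms by (auto simp: bounded_clinear_def)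
  have "\<exists>u. \<forall>x. inner (A x) y = inner x u" for y
    using bounded_linear_compose[OF bounded_linear_inner_left A(1)] by (rule real_riesz)
  then obtain B where "\<And>x y. inner (A x) y = inner x (B y)" by metis
  then have "\<And>x y. cinner (A x) y = cinner x (B y)"
    by (simp add: cinner_eq_inner flip: A(2))
  then show ?thesis using cadjoint_eqI by metis
qed


section \<open>Tuples of operators\<close>

text \<open>
  Index sets \<open>{1,\<dots>,d}\<close> are finite types; words are lists. \<^term>\<open>foldr T w\<close> is the
  composition \<open>T i\<^sub>1 \<circ> \<dots> \<circ> T i\<^sub>n\<close> for \<open>w = [i\<^sub>1, \<dots>, i\<^sub>n]\<close>, and the identity for the empty word.
\<close>

definition word_op :: "('d \<Rightarrow> 'h \<Rightarrow> 'h) \<Rightarrow> 'd list \<Rightarrow> 'h \<Rightarrow> 'h"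
  where "word_op T w = foldr T w"

definition row_contraction :: "('d::finite \<Rightarrow> 'h::chilbert_space \<Rightarrow> 'h) \<Rightarrow> bool"
  where "row_contraction T \<longleftrightarrow>
    (\<forall>k. bounded_clinear (T k)) \<and> op_le (\<lambda>x. \<Sum>k\<in>UNIV. T k (cadjoint (T k) x)) (\<lambda>x. x)"

definition commuting_tuple :: "('d \<Rightarrow> 'h \<Rightarrow> 'h) \<Rightarrow> bool"
  where "commuting_tuple T \<longleftrightarrow> (\<forall>i j. T i \<circ> T j = T j \<circ> T i)"

definition pure_tuple :: "('d::finite \<Rightarrow> 'h::chilbert_space \<Rightarrow> 'h) \<Rightarrow> bool"
  where "pure_tuple T \<longleftrightarrow>
    (\<forall>x. (\<lambda>n. \<Sum>w | length w = n. (norm (cadjoint (word_op T w) x))\<^sup>2) \<longlonglongrightarrow> 0)"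

definition cyclic_tuple :: "('d \<Rightarrow> 'h::chilbert_space \<Rightarrow> 'h) \<Rightarrow> bool"
  where "cyclic_tuple T \<longleftrightarrow> (\<exists>x. closure (cspan (range (\<lambda>w. word_op T w x))) = UNIV)"


section \<open>Square-summable families\<close>

definition sq_summable :: "('i \<Rightarrow> complex) \<Rightarrow> bool"
  where "sq_summable f \<longleftrightarrow> (\<lambda>i. (cmod (f i))\<^sup>2) summable_on UNIV"

lemma sq_summableI:
  assumes "\<And>F. finite F \<Longrightarrow> (\<Sum>i\<in>F. (cmod (f i))\<^sup>2) \<le> B"
  shows "sq_summable f"
  unfolding sq_summable_def
  by (rule nonneg_bdd_above_summable_on) (use assms in \<open>auto intro!: bdd_aboveI2\<close>)

lemma sq_summable_mono:
  assumes "sq_summable g" "\<And>i. cmod (f i) \<le> cmod (g i)"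
  shows "sq_summable f"
  unfolding sq_summable_def
  by (rule summable_on_comparison_test[OF assms(1)[unfolded sq_summable_def]])
     (simp_all add: assms(2) power_mono)

lemma sq_summable_add:
  assumes "sq_summable f" "sq_summable g"
  shows "sq_summable (\<lambda>i. f i + g i)"
proof -
  have "(\<lambda>i. 2 * (cmod (f i))\<^sup>2 + 2 * (cmod (g i))\<^sup>2) summable_on UNIV"
    using assms unfolding sq_summable_def
    by (intro summable_on_add summable_on_cmult_right)
  moreover have "(cmod (f i + g i))\<^sup>2 \<le> 2 * (cmod (f i))\<^sup>2 + 2 * (cmod (g i))\<^sup>2" for i
  proof -
    have "(cmod (f i + g i))\<^sup>2 \<le> (cmod (f i) + cmod (g i))\<^sup>2"
      by (intro power_mono norm_triangle_ineq) simp
    also have "\<dots> \<le> 2 * (cmod (f i))\<^sup>2 + 2 * (cmod (g i))\<^sup>2"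
      using sum_squares_bound[of "cmod (f i)" "cmod (g i)"] by (simp add: power2_sum)
    finally show ?thesis .
  qed
  ultimately show ?thesis unfolding sq_summable_def by (rule summable_on_comparison_test) auto
qed

lemma sq_summable_cmult: "sq_summable f \<Longrightarrow> sq_summable (\<lambda>i. c * f i)"
  unfolding sq_summable_def norm_mult power_mult_distrib by (rule summable_on_cmult_right)

lemma sq_summable_mult:
  assumes "sq_summable f" "sq_summable g"
  shows "(\<lambda>i. f i * cnj (g i)) summable_on UNIV"
proof (rule abs_summable_summable)
  have "(\<lambda>i. (cmod (f i))\<^sup>2 + (cmod (g i))\<^sup>2) summable_on UNIV"
    using assms unfolding sq_summable_def by (rule summable_on_add)
  moreover have "norm (f i * cnj (g i)) \<le> (cmod (f i))\<^sup>2 + (cmod (g i))\<^sup>2" for i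
    using sum_squares_bound[of "cmod (f i)" "cmod (g i)"]
      mult_nonneg_nonneg[OF norm_ge_zero[of "f i"] norm_ge_zero[of "g i"]]
    unfolding norm_mult complex_mod_cnj by linarith
  ultimately show "(\<lambda>i. norm (f i * cnj (g i))) summable_on UNIV"
    by (rule summable_on_comparison_test) auto
qed

typedef 'i ell2 = "{f :: 'i \<Rightarrow> complex. sq_summable f}"
  morphisms ell2_nth Abs_ell2
proof
  show "(\<lambda>_. 0) \<in> {f :: 'i \<Rightarrow> complex. sq_summable f}" by (simp add: sq_summable_def)
qed

setup_lifting type_definition_ell2

lemma sq_summable_ell2_nth [simp]: "sq_summable (ell2_nth f)"
  using ell2_nth by blast

lemma ell2_eqI: "(\<And>i. ell2_nth f i = ell2_nth g i) \<Longrightarrow> f = g"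
  by (metis ell2_nth_inject ext)

instantiation ell2 :: (type) complex_inner
begin

lift_definition zero_ell2 :: "'a ell2" is "\<lambda>_. 0" by (simp add: sq_summable_def)
lift_definition plus_ell2 :: "'a ell2 \<Rightarrow> 'a ell2 \<Rightarrow> 'a ell2" is "\<lambda>f g i. f i + g i"
  by (rule sq_summable_add)
lift_definition uminus_ell2 :: "'a ell2 \<Rightarrow> 'a ell2" is "\<lambda>f i. - f i"
  by (simp add: sq_summable_def)
lift_definition minus_ell2 :: "'a ell2 \<Rightarrow> 'a ell2 \<Rightarrow> 'a ell2" is "\<lambda>f g i. f i - g i"
proof -
  fix f g :: "'a \<Rightarrow> complex" assume "sq_summable f" "sq_summable g"
  from sq_summable_add[OF this(1) sq_summable_cmult[OF this(2), of "-1"]]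
  show "sq_summable (\<lambda>i. f i - g i)" by simp
qed
lift_definition scaleR_ell2 :: "real \<Rightarrow> 'a ell2 \<Rightarrow> 'a ell2" is "\<lambda>r f i. complex_of_real r * f i"
  by (rule sq_summable_cmult)
lift_definition scaleC_ell2 :: "complex \<Rightarrow> 'a ell2 \<Rightarrow> 'a ell2" is "\<lambda>c f i. c * f i"
  by (rule sq_summable_cmult)

definition cinner_ell2 :: "'a ell2 \<Rightarrow> 'a ell2 \<Rightarrow> complex"
  where "cinner_ell2 f g = (\<Sum>\<^sub>\<infinity>i. ell2_nth f i * cnj (ell2_nth g i))"
definition inner_ell2 :: "'a ell2 \<Rightarrow> 'a ell2 \<Rightarrow> real"
  where "inner_ell2 f g = Re (cinner f g)"
definition norm_ell2 :: "'a ell2 \<Rightarrow> real"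
  where "norm_ell2 f = sqrt (inner f f)"
definition sgn_ell2 :: "'a ell2 \<Rightarrow> 'a ell2"
  where "sgn_ell2 f = inverse (norm f) *\<^sub>R f"
definition dist_ell2 :: "'a ell2 \<Rightarrow> 'a ell2 \<Rightarrow> real"
  where "dist_ell2 f g = norm (f - g)"
definition uniformity_ell2 :: "('a ell2 \<times> 'a ell2) filter"
  where "uniformity_ell2 = (INF e\<in>{0<..}. principal {(x, y). dist x y < e})"
definition open_ell2 :: "'a ell2 set \<Rightarrow> bool"
  where "open_ell2 U \<longleftrightarrow> (\<forall>x\<in>U. eventually (\<lambda>(x', y). x' = x \<longrightarrow> y \<in> U) uniformity)"

lemma ell2_self: "cinner f f = complex_of_real (\<Sum>\<^sub>\<infinity>i. (cmod (ell2_nth f i))\<^sup>2)"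
  for f :: "'a ell2"
proof -
  have "cinner f f = (\<Sum>\<^sub>\<infinity>i. complex_of_real ((cmod (ell2_nth f i))\<^sup>2))"
    unfolding cinner_ell2_def by (simp only: complex_norm_square)
  also have "\<dots> = complex_of_real (\<Sum>\<^sub>\<infinity>i. (cmod (ell2_nth f i))\<^sup>2)"
    by (intro infsumI has_sum_of_real has_sum_infsum) (simp flip: sq_summable_def)
  finally show ?thesis .
qed

instance
proof
  fix f g h :: "'a ell2" and a b :: complex and r s :: real
  show "f + g + h = f + (g + h)" by transfer (simp add: add.assoc)
  show "f + g = g + f" by transfer (simp add: add.commute)
  show "0 + f = f" by transfer simp
  show "- f + f = 0" by transfer simp
  show "f - g = f + - g" by transfer simp
  show "r *\<^sub>R (f + g) = r *\<^sub>R f + r *\<^sub>R g" by transfer (simp add: algebra_simps)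
  show "(r + s) *\<^sub>R f = r *\<^sub>R f + s *\<^sub>R f" by transfer (simp add: algebra_simps)
  show "r *\<^sub>R s *\<^sub>R f = (r * s) *\<^sub>R f" by transfer (simp add: algebra_simps)
  show "1 *\<^sub>R f = f" by transfer simp
  show "a *\<^sub>C (f + g) = a *\<^sub>C f + a *\<^sub>C g" by transfer (simp add: algebra_simps)
  show "(a + b) *\<^sub>C f = a *\<^sub>C f + b *\<^sub>C f" by transfer (simp add: algebra_simps)
  show "a *\<^sub>C b *\<^sub>C f = (a * b) *\<^sub>C f" by transfer (simp add: algebra_simps)
  show "1 *\<^sub>C f = f" by transfer simp
  show "r *\<^sub>R f = complex_of_real r *\<^sub>C f" by transfer simp
  show "sgn f = inverse (norm f) *\<^sub>R f" by (rule sgn_ell2_def)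
  show "dist f g = norm (f - g)" by (rule dist_ell2_def)
  show "uniformity = (INF e\<in>{0<..}. principal {(x :: 'a ell2, y). dist x y < e})"
    by (rule uniformity_ell2_def)
  show "open U = (\<forall>x\<in>U. eventually (\<lambda>(x', y). x' = x \<longrightarrow> y \<in> U) uniformity)" for U :: "'a ell2 set"
    by (rule open_ell2_def)
  show comm: "cinner f g = cnj (cinner g f)" for f g :: "'a ell2"
    unfolding cinner_ell2_def infsum_cnj[symmetric] by (simp add: mult.commute)
  show addl: "cinner (f + g) h = cinner f h + cinner g h" for f g h :: "'a ell2"
    unfolding cinner_ell2_def plus_ell2.rep_eq distrib_right
    by (intro infsum_add sq_summable_mult) auto
  show scl: "cinner (a *\<^sub>C f) g = a * cinner f g" for a and f g :: "'a ell2"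
    unfolding cinner_ell2_def scaleC_ell2.rep_eq mult.assoc
    by (intro infsum_cmult_right sq_summable_mult) auto
  show "inner f g = Re (cinner f g)" by (rule inner_ell2_def)
  show "inner f g = inner g f" unfolding inner_ell2_def using comm[of f g] by simp
  show "inner (f + g) h = inner f h + inner g h" by (simp add: inner_ell2_def addl)
  have "r *\<^sub>R f = complex_of_real r *\<^sub>C f" by transfer simp
  then show "inner (r *\<^sub>R f) g = r * inner f g" by (simp add: inner_ell2_def scl)
  show "0 \<le> inner f f" by (simp add: inner_ell2_def ell2_self infsum_nonneg)
  show "norm f = sqrt (inner f f)" by (rule norm_ell2_def)
  show "(inner f f = 0) = (f = 0)"
  proof
    assume "inner f f = 0"
    then have "(\<Sum>\<^sub>\<infinity>i. (cmod (ell2_nth f i))\<^sup>2) = 0" by (simp add: inner_ell2_def ell2_self)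
    then have "(cmod (ell2_nth f i))\<^sup>2 = 0" for i
      by (intro nonneg_infsum_le_0D[where A = UNIV and f = "\<lambda>i. (cmod (ell2_nth f i))\<^sup>2"])
         (use sq_summable_ell2_nth[of f] in \<open>auto simp: sq_summable_def\<close>)
    then show "f = 0" by (intro ell2_eqI) (simp add: zero_ell2.rep_eq)
  next
    assume "f = 0"
    then show "inner f f = 0" by (simp add: inner_ell2_def ell2_self zero_ell2.rep_eq)
  qed
qed

end

lemma ell2_norm_sq: "(norm f)\<^sup>2 = (\<Sum>\<^sub>\<infinity>i. (cmod (ell2_nth f i))\<^sup>2)"
  by (simp add: power2_norm_eq_inner inner_eq_Re_cinner ell2_self)

lemma ell2_sum_le_norm: "finite F \<Longrightarrow> (\<Sum>i\<in>F. (cmod (ell2_nth f i))\<^sup>2) \<le> (norm f)\<^sup>2"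
  unfolding ell2_norm_sq
  by (rule finite_sum_le_infsum) (use sq_summable_ell2_nth[of f] in \<open>auto simp: sq_summable_def\<close>)

lemma ell2_nth_le_norm: "cmod (ell2_nth f i) \<le> norm f"
proof (rule power2_le_imp_le)
  show "(cmod (ell2_nth f i))\<^sup>2 \<le> (norm f)\<^sup>2" using ell2_sum_le_norm[of "{i}" f] by simp
qed simp

lemma ell2_norm_leI:
  assumes "\<And>F. finite F \<Longrightarrow> (\<Sum>i\<in>F. (cmod (ell2_nth f i))\<^sup>2) \<le> e\<^sup>2" "0 \<le> e"
  shows "norm f \<le> e"
proof -
  have "(norm f)\<^sup>2 \<le> e\<^sup>2" unfolding ell2_norm_sq
    by (rule infsum_le_finite_sums) (use assms sq_summable_ell2_nth[of f] in \<open>auto simp: sq_summable_def\<close>)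
  then show ?thesis using assms(2) by (rule power2_le_imp_le)
qed

instance ell2 :: (type) chilbert_space
proof
  fix X :: "nat \<Rightarrow> 'a ell2" assume X: "Cauchy X"
  have nthdiff: "ell2_nth (f - g) i = ell2_nth f i - ell2_nth g i" for f g :: "'a ell2" and i
    by (simp add: minus_ell2.rep_eq)
  have "Cauchy (\<lambda>n. ell2_nth (X n) i)" for i
  proof (rule metric_CauchyI)
    fix e :: real assume "0 < e"
    then obtain N where "\<And>m n. m \<ge> N \<Longrightarrow> n \<ge> N \<Longrightarrow> dist (X m) (X n) < e"
      using metric_CauchyD[OF X] by blast
    then show "\<exists>M. \<forall>m\<ge>M. \<forall>n\<ge>M. dist (ell2_nth (X m) i) (ell2_nth (X n) i) < e"
      by (metis dist_norm nthdiff ell2_nth_le_norm le_less_trans)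
  qed
  then have "\<exists>l. (\<lambda>n. ell2_nth (X n) i) \<longlonglongrightarrow> l" for i
    using Cauchy_convergent convergent_def by blast
  then obtain L where L: "\<And>i. (\<lambda>n. ell2_nth (X n) i) \<longlonglongrightarrow> L i" by metis
  have bound: "\<exists>N. \<forall>n\<ge>N. \<forall>F. finite F \<longrightarrow> (\<Sum>i\<in>F. (cmod (ell2_nth (X n) i - L i))\<^sup>2) \<le> e\<^sup>2"
    if e: "0 < e" for e
  proof -
    obtain N where N: "\<And>m n. m \<ge> N \<Longrightarrow> n \<ge> N \<Longrightarrow> dist (X m) (X n) < e"
      using metric_CauchyD[OF X e] by blast
    have "(\<Sum>i\<in>F. (cmod (ell2_nth (X n) i - L i))\<^sup>2) \<le> e\<^sup>2" if "n \<ge> N" "finite F" for n F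
    proof (rule LIMSEQ_le_const2)
      show "(\<lambda>m. \<Sum>i\<in>F. (cmod (ell2_nth (X n) i - ell2_nth (X m) i))\<^sup>2)
        \<longlonglongrightarrow> (\<Sum>i\<in>F. (cmod (ell2_nth (X n) i - L i))\<^sup>2)"
        by (intro tendsto_intros L)
      have "(\<Sum>i\<in>F. (cmod (ell2_nth (X n) i - ell2_nth (X m) i))\<^sup>2) \<le> e\<^sup>2" if "m \<ge> N" for m
      proof -
        have "(\<Sum>i\<in>F. (cmod (ell2_nth (X n) i - ell2_nth (X m) i))\<^sup>2) \<le> (norm (X n - X m))\<^sup>2"
          using ell2_sum_le_norm[OF \<open>finite F\<close>, of "X n - X m"] by (simp add: nthdiff)
        also have "\<dots> \<le> e\<^sup>2"
          using N[OF \<open>n \<ge> N\<close> that] by (intro power_mono) (auto simp: dist_norm)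
        finally show ?thesis .
      qed
      then show "\<exists>M. \<forall>m\<ge>M. (\<Sum>i\<in>F. (cmod (ell2_nth (X n) i - ell2_nth (X m) i))\<^sup>2) \<le> e\<^sup>2"
        by blast
    qed
    then show ?thesis by blast
  qed
  obtain n where "\<forall>F. finite F \<longrightarrow> (\<Sum>i\<in>F. (cmod (ell2_nth (X n) i - L i))\<^sup>2) \<le> 1\<^sup>2"
    using bound[of 1] by auto
  then have "sq_summable (\<lambda>i. ell2_nth (X n) i - L i)" by (intro sq_summableI) auto
  from sq_summable_add[OF sq_summable_ell2_nth[of "X n"] sq_summable_cmult[OF this, of "-1"]]
  have "sq_summable L" by simp
  then have nthL: "ell2_nth (Abs_ell2 L) = L" by (simp add: Abs_ell2_inverse)
  have "X \<longlonglongrightarrow> Abs_ell2 L"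
  proof (rule metric_LIMSEQ_I)
    fix e :: real assume "0 < e"
    then obtain N where N: "\<forall>n\<ge>N. \<forall>F. finite F \<longrightarrow> (\<Sum>i\<in>F. (cmod (ell2_nth (X n) i - L i))\<^sup>2) \<le> (e/2)\<^sup>2"
      using bound[of "e/2"] by auto
    have "dist (X n) (Abs_ell2 L) < e" if "n \<ge> N" for n
    proof -
      have "norm (X n - Abs_ell2 L) \<le> e/2"
        using N that \<open>0 < e\<close> by (intro ell2_norm_leI) (auto simp: nthdiff nthL)
      then show ?thesis using \<open>0 < e\<close> by (simp add: dist_norm)
    qed
    then show "\<exists>N. \<forall>n\<ge>N. dist (X n) (Abs_ell2 L) < e" by blast
  qed
  then show "convergent X" by (auto simp: convergent_def)
qed


section \<open>The full Fock space\<close>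

text \<open>
  The tensor power \<open>(\<complex>\<^sup>d)\<^sup>\<otimes>\<^sup>n\<close> is given in its orthonormal basis
  \<open>e\<^sub>w = e\<^sub>i\<^sub>1 \<otimes> \<dots> \<otimes> e\<^sub>i\<^sub>n\<close>, so its elements are the functions on words of length \<open>n\<close>; the
  Hilbert direct sum over all \<open>n\<close> then consists of the square-summable functions on words.
  The empty word gives the vacuum summand.
\<close>

type_synonym 'd fock = "'d list ell2"

lift_definition fock_basis :: "'d list \<Rightarrow> 'd fock" is "\<lambda>w v. if v = w then 1 else 0"
proof (rule sq_summableI)
  fix w :: "'d list" and F :: "'d list set" assume F: "finite F"
  have "(\<Sum>v\<in>F. (cmod (if v = w then 1 else 0))\<^sup>2) = (\<Sum>v\<in>F. if v = w then 1 else 0)"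
    by (intro sum.cong) auto
  also have "\<dots> \<le> (1::real)" using F by simp
  finally show "(\<Sum>v\<in>F. (cmod (if v = w then 1 else 0))\<^sup>2) \<le> 1" .
qed

abbreviation vacuum :: "'d fock" where "vacuum \<equiv> fock_basis []"

text \<open>\<open>u \<otimes> v\<close> for \<open>u\<close> in \<open>\<complex>\<^sup>d\<close> and \<open>v\<close> in the Fock space; here \<open>u \<otimes> \<Omega>\<close> is \<open>u\<close> itself.\<close>

lift_definition tensor_left :: "complex ^ 'd::finite \<Rightarrow> 'd fock \<Rightarrow> 'd fock"
  is "\<lambda>u f w. case w of [] \<Rightarrow> 0 | i # v \<Rightarrow> u $ i * f v"
proof -
  fix u :: "complex ^ 'd" and f :: "'d list \<Rightarrow> complex" assume f: "sq_summable f"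
  let ?g = "\<lambda>w. case w of [] \<Rightarrow> 0 | i # v \<Rightarrow> u $ i * f v"
  have "(\<lambda>w. (cmod (?g w))\<^sup>2) summable_on (\<Union>i\<in>UNIV. Cons i ` UNIV)"
  proof (rule summable_on_finite_union_disjoint)
    show "(\<lambda>w. (cmod (?g w))\<^sup>2) summable_on Cons i ` UNIV" for i
      using sq_summable_cmult[OF f, of "u $ i"]
      by (subst summable_on_reindex) (auto simp: o_def sq_summable_def)
  qed auto
  also have "?this \<longleftrightarrow> (\<lambda>w. (cmod (?g w))\<^sup>2) summable_on UNIV"
  proof (rule summable_on_cong_neutral)
    fix w :: "'d list" assume "w \<in> UNIV - (\<Union>i\<in>UNIV. range (Cons i))"
    then show "(cmod (?g w))\<^sup>2 = 0" by (cases w) auto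
  qed auto
  finally show "sq_summable ?g" by (simp add: sq_summable_def)
qed

definition left_creation :: "'d::finite \<Rightarrow> 'd fock \<Rightarrow> 'd fock"
  where "left_creation k = tensor_left (axis k 1)"

lemma left_creation_basis: "left_creation k (fock_basis w) = fock_basis (k # w)"
  by (rule ell2_eqI)
     (auto simp: left_creation_def tensor_left.rep_eq fock_basis.rep_eq axis_def split: list.splits)



section \<open>The Drury--Arveson space\<close>

definition multi_deg :: "('d::finite \<Rightarrow> nat) \<Rightarrow> nat"
  where "multi_deg \<alpha> = (\<Sum>i\<in>UNIV. \<alpha> i)"

definition multi_fact :: "('d::finite \<Rightarrow> nat) \<Rightarrow> nat"
  where "multi_fact \<alpha> = (\<Prod>i\<in>UNIV. fact (\<alpha> i))"

definition multi_power :: "complex ^ 'd::finite \<Rightarrow> ('d \<Rightarrow> nat) \<Rightarrow> complex"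
  where "multi_power x \<alpha> = (\<Prod>i\<in>UNIV. (x $ i) ^ \<alpha> i)"

definition da_weight :: "('d::finite \<Rightarrow> nat) \<Rightarrow> real"
  where "da_weight \<alpha> = real (multi_fact \<alpha>) / fact (multi_deg \<alpha>)"

definition has_power_series ::
    "(complex ^ 'd::finite \<Rightarrow> complex) \<Rightarrow> (('d \<Rightarrow> nat) \<Rightarrow> complex) \<Rightarrow> bool"
  where "has_power_series f c \<longleftrightarrow>
    (\<forall>x\<in>ball 0 1. ((\<lambda>\<alpha>. c \<alpha> * multi_power x \<alpha>) has_sum f x) UNIV)"

definition da_summable :: "(('d::finite \<Rightarrow> nat) \<Rightarrow> complex) \<Rightarrow> bool"
  where "da_summable c \<longleftrightarrow> (\<lambda>\<alpha>. da_weight \<alpha> * (cmod (c \<alpha>))\<^sup>2) summable_on UNIV"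


subsection \<open>Uniqueness of the coefficients\<close>

lemma powser_all_zero:
  fixes b :: "nat \<Rightarrow> complex"
  assumes "\<And>t. norm t < 1 \<Longrightarrow> (\<lambda>n. b n * t ^ n) sums 0"
  shows "b n = 0"
proof (induction n rule: less_induct)
  case (less n)
  have "(\<lambda>k. b (k + n) * t ^ k) sums 0" if "t \<noteq> 0" "norm t < 1" for t
  proof -
    have "(\<lambda>k. b (k + n) * t ^ (k + n)) sums (0 - (\<Sum>i<n. b i * t ^ i))"
      using sums_split_initial_segment[OF assms[OF that(2)], of n] .
    then have "(\<lambda>k. t ^ n * (b (k + n) * t ^ k)) sums (t ^ n * 0)"
      by (simp add: less.IH power_add mult_ac)
    then show ?thesis using that(1) by (subst (asm) sums_mult_iff) auto
  qed
  then have "((\<lambda>_. 0) \<longlongrightarrow> b (0 + n)) (at (0::complex))"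
    by (intro powser_limit_0_strong[of 1 "\<lambda>k. b (k + n)" "\<lambda>_. 0"]) auto
  then show ?case by (simp add: tendsto_const_iff)
qed

lemma digits_unique:
  fixes a b :: "nat \<Rightarrow> nat"
  assumes "\<And>j. j < m \<Longrightarrow> a j < B" "\<And>j. j < m \<Longrightarrow> b j < B"
    and "(\<Sum>j<m. a j * B ^ j) = (\<Sum>j<m. b j * B ^ j)"
  shows "\<forall>j<m. a j = b j"
  using assms
proof (induction m)
  case (Suc m)
  have bd: "(\<Sum>j<m. c j * B ^ j) < B ^ m" if "\<And>j. j < m \<Longrightarrow> c j < B" "0 < B" for c :: "nat \<Rightarrow> nat"
    using that(1)
  proof (induction m)
    case (Suc m)
    have "(\<Sum>j<Suc m. c j * B ^ j) < B ^ m + c m * B ^ m" using Suc by simp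
    also have "\<dots> = Suc (c m) * B ^ m" by simp
    also have "\<dots> \<le> B * B ^ m" using Suc.prems[of m] by (intro mult_right_mono) auto
    finally show ?case by simp
  qed simp
  have B: "0 < B" using Suc.prems(1)[of 0] by simp
  have ba: "(\<Sum>j<m. a j * B ^ j) < B ^ m" and bb: "(\<Sum>j<m. b j * B ^ j) < B ^ m"
    using Suc.prems(1,2) B by (auto intro!: bd)
  have eq: "(\<Sum>j<m. a j * B ^ j) + a m * B ^ m = (\<Sum>j<m. b j * B ^ j) + b m * B ^ m"
    using Suc.prems(3) by simp
  have "a m = ((\<Sum>j<m. a j * B ^ j) + a m * B ^ m) div B ^ m" using ba B by simp
  also have "\<dots> = b m" unfolding eq using bb B by simp
  finally have "a m = b m" .
  moreover from this eq have "\<forall>j<m. a j = b j" using Suc.prems by (intro Suc.IH) auto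
  ultimately show ?case by (auto simp: less_Suc_eq)
qed simp

lemma multi_power_zero_unique:
  fixes c :: "('d::finite \<Rightarrow> nat) \<Rightarrow> complex"
  assumes "finite A" "\<And>x. (\<Sum>\<alpha>\<in>A. c \<alpha> * multi_power x \<alpha>) = 0" "\<beta> \<in> A"
  shows "c \<beta> = 0"
proof -
  obtain idx :: "'d \<Rightarrow> nat" where idx: "bij_betw idx UNIV {..<CARD('d)}"
    using ex_bij_betw_finite_nat[of "UNIV :: 'd set"] by (auto simp: lessThan_atLeast0)
  define B where "B = Suc (\<Sum>\<alpha>\<in>A. multi_deg \<alpha>)"
  have B: "\<alpha> i < B" if "\<alpha> \<in> A" for \<alpha> i
  proof -
    have "\<alpha> i \<le> multi_deg \<alpha>" unfolding multi_deg_def by (rule member_le_sum) auto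
    also have "\<dots> \<le> (\<Sum>\<alpha>\<in>A. multi_deg \<alpha>)" using assms(1) that by (intro member_le_sum) auto
    finally show ?thesis by (simp add: B_def)
  qed
  define key where "key \<alpha> = (\<Sum>i\<in>UNIV. \<alpha> i * B ^ idx i)" for \<alpha>
  define inx where "inx = inv_into UNIV idx"
  have inx: "inx (idx i) = i" for i using idx by (simp add: inx_def bij_betw_def)
  have key: "key \<alpha> = (\<Sum>j<CARD('d). \<alpha> (inx j) * B ^ j)" for \<alpha>
    using sum.reindex_bij_betw[OF idx, of "\<lambda>j. \<alpha> (inx j) * B ^ j"] by (simp add: key_def inx)
  have inj: "\<alpha> = \<gamma>" if "\<alpha> \<in> A" "\<gamma> \<in> A" "key \<alpha> = key \<gamma>" for \<alpha> \<gamma>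
  proof -
    have "\<forall>j<CARD('d). \<alpha> (inx j) = \<gamma> (inx j)"
      using that B unfolding key by (intro digits_unique[where B = B]) auto
    moreover have "idx i < CARD('d)" for i using idx by (auto simp: bij_betw_def)
    ultimately show ?thesis by (metis inx ext)
  qed
  define p where "p = (\<Sum>\<alpha>\<in>A. monom (c \<alpha>) (key \<alpha>))"
  have "poly p t = 0" for t
  proof -
    have "multi_power (\<chi> i. t ^ (B ^ idx i)) \<alpha> = t ^ key \<alpha>" for \<alpha>
      by (simp add: multi_power_def key_def power_sum mult.commute flip: power_mult)
    then show ?thesis using assms(2)[of "\<chi> i. t ^ (B ^ idx i)"]
      by (simp add: p_def poly_sum poly_monom)
  qed
  then have "p = 0" using poly_all_0_iff_0 by blast
  then have "0 = coeff p (key \<beta>)" by simp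
  also have "\<dots> = (\<Sum>\<alpha>\<in>A. if \<alpha> = \<beta> then c \<alpha> else 0)"
    unfolding p_def coeff_sum by (rule sum.cong) (use inj assms(3) in auto)
  also have "\<dots> = c \<beta>" using assms(1,3) by simp
  finally show ?thesis by simp
qed

lemma finite_multi_deg: "finite {\<alpha> :: 'd::finite \<Rightarrow> nat. multi_deg \<alpha> = n}"
proof (rule finite_subset)
  show "{\<alpha> :: 'd \<Rightarrow> nat. multi_deg \<alpha> = n} \<subseteq> (\<Pi>\<^sub>E i\<in>UNIV. {..n})"
    unfolding multi_deg_def by (auto simp: PiE_def intro: member_le_sum)
qed (simp add: finite_PiE)

lemma multi_power_scale:
  "multi_power (\<chi> i. t * x $ i) \<alpha> = t ^ multi_deg \<alpha> * multi_power x \<alpha>"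
  by (simp add: multi_power_def multi_deg_def power_mult_distrib prod.distrib power_sum)

lemma has_power_series_0:
  fixes c :: "('d::finite \<Rightarrow> nat) \<Rightarrow> complex"
  assumes "has_power_series (\<lambda>_. 0) c"
  shows "c \<beta> = 0"
proof -
  let ?A = "\<lambda>n. {\<alpha> :: 'd \<Rightarrow> nat. multi_deg \<alpha> = n}"
  define b where "b x n = (\<Sum>\<alpha>\<in>?A n. c \<alpha> * multi_power x \<alpha>)" for x n
  have norm_scale: "norm (\<chi> i. t * x $ i) = norm t * norm x" for t and x :: "complex ^ 'd"
    by (simp add: norm_vec_def norm_mult L2_set_right_distrib)
  have b0: "b x n = 0" if x: "norm x < 1" for x n
  proof (rule powser_all_zero)
    fix t :: complex assume t: "norm t < 1"
    have "norm t * norm x < 1" using x t by (metis mult_le_one norm_ge_zero less_le mult_less_cancel_right2 not_less order.strict_trans1 mult_left_le_one_le)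
    then have "((\<lambda>\<alpha>. c \<alpha> * multi_power (\<chi> i. t * x $ i) \<alpha>) has_sum 0) UNIV"
      using assms by (simp add: has_power_series_def norm_scale)
    then have "((\<lambda>(n, \<alpha>). c \<alpha> * multi_power (\<chi> i. t * x $ i) \<alpha>) has_sum 0) (Sigma UNIV ?A)"
      by (subst (asm) has_sum_reindex_bij_witness[where i = snd and j = "\<lambda>\<alpha>. (multi_deg \<alpha>, \<alpha>)"
            and T = "Sigma UNIV ?A" and s' = 0
            and h = "\<lambda>(n, \<alpha>). c \<alpha> * multi_power (\<chi> i. t * x $ i) \<alpha>"]) auto
    then have "((\<lambda>n. b x n * t ^ n) has_sum 0) UNIV"
    proof (rule has_sum_Sigma')
      fix n
      have "(\<Sum>\<alpha>\<in>?A n. c \<alpha> * multi_power (\<chi> i. t * x $ i) \<alpha>) = b x n * t ^ n"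
        unfolding b_def sum_distrib_right by (intro sum.cong) (auto simp: multi_power_scale)
      then show "((\<lambda>\<alpha>. case (n, \<alpha>) of (n, \<alpha>) \<Rightarrow> c \<alpha> * multi_power (\<chi> i. t * x $ i) \<alpha>)
          has_sum b x n * t ^ n) (?A n)"
        by (simp add: has_sum_finiteI[OF finite_multi_deg])
    qed
    then show "(\<lambda>n. b x n * t ^ n) sums 0" by (rule has_sum_imp_sums)
  qed
  have "(\<Sum>\<alpha>\<in>?A n. c \<alpha> * multi_power x \<alpha>) = 0" for x n
  proof -
    define r where "r = 1 / (1 + norm x)"
    have nx: "0 < 1 + norm x" by (smt (verit) norm_ge_zero)
    have r: "r \<noteq> 0" "r * norm x < 1" "\<bar>r\<bar> = r" using nx by (auto simp: r_def)
    have "0 = b (\<chi> i. of_real r * x $ i) n" using r by (subst b0) (auto simp: norm_scale)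
    also have "\<dots> = of_real r ^ n * b x n"
      unfolding b_def sum_distrib_left by (intro sum.cong) (auto simp: multi_power_scale)
    finally show ?thesis using r by (simp add: b_def)
  qed
  then show ?thesis
    using multi_power_zero_unique[of "?A (multi_deg \<beta>)" c \<beta>] finite_multi_deg by auto
qed

lemma has_power_series_add:
  "has_power_series f c \<Longrightarrow> has_power_series g d \<Longrightarrow>
    has_power_series (\<lambda>x. f x + g x) (\<lambda>\<alpha>. c \<alpha> + d \<alpha>)"
  by (simp add: has_power_series_def distrib_right has_sum_add)

lemma has_power_series_cmult:
  "has_power_series f c \<Longrightarrow> has_power_series (\<lambda>x. a * f x) (\<lambda>\<alpha>. a * c \<alpha>)"
  by (simp add: has_power_series_def mult.assoc has_sum_cmult_right)

lemma has_power_series_unique: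
  assumes "has_power_series f c" "has_power_series f d"
  shows "c = d"
proof
  fix \<alpha>
  have "has_power_series (\<lambda>x. f x + -1 * f x) (\<lambda>\<alpha>. c \<alpha> + -1 * d \<alpha>)"
    by (intro has_power_series_add has_power_series_cmult assms)
  then have "c \<alpha> + -1 * d \<alpha> = 0" by (intro has_power_series_0) simp
  then show "c \<alpha> = d \<alpha>" by simp
qed


subsection \<open>Convergence on the ball\<close>

lemma da_weight_pos [simp]: "0 < da_weight \<alpha>"
  by (simp add: da_weight_def multi_fact_def prod_pos)

lemma da_weight_nonneg [simp]: "0 \<le> da_weight \<alpha>" and da_weight_nonzero [simp]: "da_weight \<alpha> \<noteq> 0"
  using da_weight_pos[of \<alpha>] by linarith+

lemma da_summable_iff: "da_summable c \<longleftrightarrow> sq_summable (\<lambda>\<alpha>. of_real (sqrt (da_weight \<alpha>)) * c \<alpha>)"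
  by (simp add: da_summable_def sq_summable_def norm_mult power_mult_distrib)

lemma multi_deg_upd: "multi_deg (\<alpha>(k := Suc (\<alpha> k))) = Suc (multi_deg \<alpha>)"
proof -
  have "multi_deg (\<alpha>(k := Suc (\<alpha> k))) = Suc (\<alpha> k) + (\<Sum>i\<in>UNIV - {k}. \<alpha> i)"
    unfolding multi_deg_def by (subst sum.remove[of _ k]) auto
  also have "\<dots> = Suc (multi_deg \<alpha>)"
    unfolding multi_deg_def by (subst (2) sum.remove[of _ k]) auto
  finally show ?thesis .
qed

lemma prod_upd:
  fixes h :: "'d::finite \<Rightarrow> nat \<Rightarrow> 'b::comm_monoid_mult"
  assumes "h k (Suc (\<alpha> k)) = z * h k (\<alpha> k)"
  shows "(\<Prod>i\<in>UNIV. h i ((\<alpha>(k := Suc (\<alpha> k))) i)) = z * (\<Prod>i\<in>UNIV. h i (\<alpha> i))"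
proof -
  have "(\<Prod>i\<in>UNIV. h i ((\<alpha>(k := Suc (\<alpha> k))) i)) = h k (Suc (\<alpha> k)) * (\<Prod>i\<in>UNIV - {k}. h i (\<alpha> i))"
    by (subst prod.remove[of _ k]) auto
  also have "\<dots> = z * (\<Prod>i\<in>UNIV. h i (\<alpha> i))"
    unfolding assms by (subst (2) prod.remove[of _ k]) (auto simp: mult.assoc)
  finally show ?thesis .
qed

lemma da_weight_upd:
  "da_weight (\<alpha>(k := Suc (\<alpha> k))) = real (Suc (\<alpha> k)) / real (Suc (multi_deg \<alpha>)) * da_weight \<alpha>"
proof -
  have "multi_fact (\<alpha>(k := Suc (\<alpha> k))) = Suc (\<alpha> k) * multi_fact \<alpha>"
    unfolding multi_fact_def by (rule prod_upd[where h = "\<lambda>_. fact"]) simp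
  then show ?thesis by (simp add: da_weight_def multi_deg_upd distrib_right)
qed

lemma multi_power_upd:
  "multi_power x (\<alpha>(k := Suc (\<alpha> k))) = x $ k * multi_power x \<alpha>"
  unfolding multi_power_def by (rule prod_upd[where h = "\<lambda>i m. (x $ i) ^ m"]) simp

lemma multinomial_sum:
  fixes y :: "'d::finite \<Rightarrow> real"
  shows "(\<Sum>\<alpha> | multi_deg \<alpha> = n. (\<Prod>i\<in>UNIV. y i ^ \<alpha> i) / da_weight \<alpha>) = (\<Sum>i\<in>UNIV. y i) ^ n"
proof (induction n)
  case 0
  have "{\<alpha> :: 'd \<Rightarrow> nat. multi_deg \<alpha> = 0} = {\<lambda>_. 0}" by (auto simp: multi_deg_def)
  then show ?case by (simp add: da_weight_def multi_fact_def multi_deg_def)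
next
  case (Suc n)
  let ?A = "\<lambda>n. {\<alpha> :: 'd \<Rightarrow> nat. multi_deg \<alpha> = n}"
  let ?t = "\<lambda>\<alpha> :: 'd \<Rightarrow> nat. (\<Prod>i\<in>UNIV. y i ^ \<alpha> i) / da_weight \<alpha>"
  have up: "y k * ?t \<alpha> = real (Suc (\<alpha> k)) / real (Suc n) * ?t (\<alpha>(k := Suc (\<alpha> k)))"
    if "\<alpha> \<in> ?A n" for \<alpha> k
  proof -
    have "(\<Prod>i\<in>UNIV. y i ^ (\<alpha>(k := Suc (\<alpha> k))) i) = y k * (\<Prod>i\<in>UNIV. y i ^ \<alpha> i)"
      by (rule prod_upd[where h = "\<lambda>i m. y i ^ m"]) simp
    then show ?thesis using that by (simp add: da_weight_upd del: of_nat_Suc)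
  qed
  have inner_sum: "(\<Sum>\<alpha>\<in>?A n. y k * ?t \<alpha>) = (\<Sum>\<beta>\<in>?A (Suc n). real (\<beta> k) / real (Suc n) * ?t \<beta>)" for k
  proof -
    have "(\<Sum>\<alpha>\<in>?A n. y k * ?t \<alpha>) = (\<Sum>\<beta>\<in>{\<beta> \<in> ?A (Suc n). \<beta> k \<noteq> 0}. real (\<beta> k) / real (Suc n) * ?t \<beta>)"
    proof (rule sum.reindex_bij_witness[where i = "\<lambda>\<beta>. \<beta>(k := \<beta> k - 1)" and j = "\<lambda>\<alpha>. \<alpha>(k := Suc (\<alpha> k))"])
      fix \<beta> assume "\<beta> \<in> {\<beta> \<in> ?A (Suc n). \<beta> k \<noteq> 0}"
      then show "\<beta>(k := \<beta> k - 1) \<in> ?A n"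
        using multi_deg_upd[of "\<beta>(k := \<beta> k - 1)" k] by simp
    next
      fix \<alpha> assume "\<alpha> \<in> ?A n"
      from up[OF this, of k]
      show "real ((\<alpha>(k := Suc (\<alpha> k))) k) / real (Suc n) * ?t (\<alpha>(k := Suc (\<alpha> k))) = y k * ?t \<alpha>"
        by (simp only: fun_upd_same)
    qed (auto simp: multi_deg_upd)
    also have "\<dots> = (\<Sum>\<beta>\<in>?A (Suc n). real (\<beta> k) / real (Suc n) * ?t \<beta>)"
      by (rule sum.mono_neutral_left) (auto simp: finite_multi_deg)
    finally show ?thesis .
  qed
  have "(\<Sum>i\<in>UNIV. y i) ^ Suc n = (\<Sum>k\<in>UNIV. \<Sum>\<alpha>\<in>?A n. y k * ?t \<alpha>)"
    by (simp add: Suc.IH[symmetric] sum_product)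
  also have "\<dots> = (\<Sum>\<beta>\<in>?A (Suc n). \<Sum>k\<in>UNIV. real (\<beta> k) / real (Suc n) * ?t \<beta>)"
    unfolding inner_sum by (rule sum.swap)
  also have "\<dots> = (\<Sum>\<beta>\<in>?A (Suc n). ?t \<beta>)"
  proof (rule sum.cong)
    fix \<beta> assume "\<beta> \<in> ?A (Suc n)"
    then have "real (\<Sum>k\<in>UNIV. \<beta> k) = real (Suc n)" by (simp add: multi_deg_def)
    then show "(\<Sum>k\<in>UNIV. real (\<beta> k) / real (Suc n) * ?t \<beta>) = ?t \<beta>"
      by (simp flip: sum_distrib_right sum_divide_distrib)
  qed simp
  finally show ?case by simp
qed

lemma sq_summable_kernel:
  fixes x :: "complex ^ 'd::finite"
  assumes "norm x < 1"
  shows "sq_summable (\<lambda>\<alpha>. multi_power x \<alpha> / of_real (sqrt (da_weight \<alpha>)))"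
proof (rule sq_summableI)
  fix F :: "('d \<Rightarrow> nat) set" assume F: "finite F"
  define s where "s = (\<Sum>i\<in>UNIV. (cmod (x $ i))\<^sup>2)"
  have "s = (norm x)\<^sup>2" by (simp add: s_def norm_vec_def L2_set_def sum_nonneg)
  then have s: "0 \<le> s" "s < 1" using assms by (auto simp: power_less_one_iff)
  let ?g = "\<lambda>\<alpha> :: 'd \<Rightarrow> nat. (\<Prod>i\<in>UNIV. ((cmod (x $ i))\<^sup>2) ^ \<alpha> i) / da_weight \<alpha>"
  have g: "(cmod (multi_power x \<alpha> / of_real (sqrt (da_weight \<alpha>))))\<^sup>2 = ?g \<alpha>" for \<alpha>
    by (simp add: multi_power_def norm_divide power_divide prod_norm[symmetric] norm_power prod_power_distrib
        power_mult[symmetric] mult.commute)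
  define N where "N = Suc (\<Sum>\<alpha>\<in>F. multi_deg \<alpha>)"
  have sub: "F \<subseteq> (\<Union>n\<in>{..<N}. {\<alpha>. multi_deg \<alpha> = n})"
  proof
    fix \<alpha> assume "\<alpha> \<in> F"
    then have "multi_deg \<alpha> \<le> (\<Sum>\<alpha>\<in>F. multi_deg \<alpha>)" using F by (intro member_le_sum) auto
    then show "\<alpha> \<in> (\<Union>n\<in>{..<N}. {\<alpha>. multi_deg \<alpha> = n})" by (simp add: N_def)
  qed
  have "(\<Sum>\<alpha>\<in>F. ?g \<alpha>) \<le> (\<Sum>\<alpha>\<in>(\<Union>n\<in>{..<N}. {\<alpha>. multi_deg \<alpha> = n}). ?g \<alpha>)"
    using sub
    by (intro sum_mono2) (auto simp: finite_multi_deg intro!: divide_nonneg_nonneg prod_nonneg)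
  also have "\<dots> = (\<Sum>n<N. \<Sum>\<alpha> | multi_deg \<alpha> = n. ?g \<alpha>)"
    by (rule sum.UNION_disjoint) (auto simp: finite_multi_deg)
  also have "\<dots> = (\<Sum>n<N. s ^ n)" by (simp add: multinomial_sum s_def)
  also have "\<dots> \<le> (\<Sum>n. s ^ n)" using s by (intro sum_le_suminf) (auto simp: summable_geometric)
  also have "\<dots> = 1 / (1 - s)" using s by (simp add: suminf_geometric)
  finally show "(\<Sum>\<alpha>\<in>F. (cmod (multi_power x \<alpha> / of_real (sqrt (da_weight \<alpha>))))\<^sup>2) \<le> 1 / (1 - s)"
    unfolding g .
qed

lemma da_summable_converges:
  assumes "da_summable c" "norm x < 1"
  shows "(\<lambda>\<alpha>. c \<alpha> * multi_power x \<alpha>) summable_on UNIV"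
proof -
  have "sq_summable (\<lambda>\<alpha>. cnj (multi_power x \<alpha> / of_real (sqrt (da_weight \<alpha>))))"
    using sq_summable_kernel[OF assms(2)] by (simp add: sq_summable_def norm_divide)
  from sq_summable_mult[OF assms(1)[unfolded da_summable_iff] this] show ?thesis
    by simp
qed


subsection \<open>The space\<close>

text \<open>
  Elements are functions on the open unit ball; totality forces a value outside the ball, which
  is fixed to be \<open>0\<close>.
\<close>

typedef (overloaded) 'd drury_arveson =
  "{f :: complex ^ 'd::finite \<Rightarrow> complex.
      (\<exists>c. has_power_series f c \<and> da_summable c) \<and> (\<forall>x. x \<notin> ball 0 1 \<longrightarrow> f x = 0)}"
  morphisms da_eval Abs_drury_arveson
proof
  show "(\<lambda>_. 0) \<in> {f :: complex ^ 'd \<Rightarrow> complex.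
      (\<exists>c. has_power_series f c \<and> da_summable c) \<and> (\<forall>x. x \<notin> ball 0 1 \<longrightarrow> f x = 0)}"
    by (auto simp: has_power_series_def da_summable_def intro!: exI[of _ "\<lambda>_. 0"])
qed

setup_lifting type_definition_drury_arveson

definition da_coeff :: "'d::finite drury_arveson \<Rightarrow> ('d \<Rightarrow> nat) \<Rightarrow> complex"
  where "da_coeff f = (THE c. has_power_series (da_eval f) c)"

lemma da_coeff_eqI: "has_power_series (da_eval f) c \<Longrightarrow> da_coeff f = c"
  unfolding da_coeff_def using has_power_series_unique by blast

lemma da_coeff: "has_power_series (da_eval f) (da_coeff f)" "da_summable (da_coeff f)"
proof -
  obtain c where "has_power_series (da_eval f) c" "da_summable c" using da_eval[of f] by blast
  then show "has_power_series (da_eval f) (da_coeff f)" "da_summable (da_coeff f)"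
    using da_coeff_eqI by metis+
qed

lemma da_eval_outside: "x \<notin> ball 0 1 \<Longrightarrow> da_eval f x = 0"
  using da_eval[of f] by blast

lemma da_summable_add: "da_summable c \<Longrightarrow> da_summable d \<Longrightarrow> da_summable (\<lambda>\<alpha>. c \<alpha> + d \<alpha>)"
  unfolding da_summable_iff using sq_summable_add by (fastforce simp: distrib_left)

lemma da_summable_cmult: "da_summable c \<Longrightarrow> da_summable (\<lambda>\<alpha>. a * c \<alpha>)"
  unfolding da_summable_iff using sq_summable_cmult[of _ a] by (simp add: mult.left_commute)

instantiation drury_arveson :: (finite) complex_inner
begin

lift_definition zero_drury_arveson :: "'a drury_arveson" is "\<lambda>_. 0"
  by (auto simp: has_power_series_def da_summable_def intro!: exI[of _ "\<lambda>_. 0"])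
lift_definition plus_drury_arveson :: "'a drury_arveson \<Rightarrow> 'a drury_arveson \<Rightarrow> 'a drury_arveson"
  is "\<lambda>f g x. f x + g x"
proof -
  fix f g :: "complex ^ 'a \<Rightarrow> complex"
  assume "(\<exists>c. has_power_series f c \<and> da_summable c) \<and> (\<forall>x. x \<notin> ball 0 1 \<longrightarrow> f x = 0)"
    and "(\<exists>c. has_power_series g c \<and> da_summable c) \<and> (\<forall>x. x \<notin> ball 0 1 \<longrightarrow> g x = 0)"
  moreover from this obtain c d where "has_power_series f c" "da_summable c"
    "has_power_series g d" "da_summable d" by blast
  then have "has_power_series (\<lambda>x. f x + g x) (\<lambda>\<alpha>. c \<alpha> + d \<alpha>)" "da_summable (\<lambda>\<alpha>. c \<alpha> + d \<alpha>)"
    by (auto intro: has_power_series_add da_summable_add)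
  ultimately show "(\<exists>c. has_power_series (\<lambda>x. f x + g x) c \<and> da_summable c) \<and>
      (\<forall>x. x \<notin> ball 0 1 \<longrightarrow> f x + g x = 0)"
    by (intro conjI exI) auto
qed
lift_definition scaleC_drury_arveson :: "complex \<Rightarrow> 'a drury_arveson \<Rightarrow> 'a drury_arveson"
  is "\<lambda>a f x. a * f x"
  using has_power_series_cmult da_summable_cmult by fastforce
definition uminus_drury_arveson :: "'a drury_arveson \<Rightarrow> 'a drury_arveson"
  where "uminus_drury_arveson f = (-1) *\<^sub>C f"
definition minus_drury_arveson :: "'a drury_arveson \<Rightarrow> 'a drury_arveson \<Rightarrow> 'a drury_arveson"
  where "minus_drury_arveson f g = f + - g"
definition scaleR_drury_arveson :: "real \<Rightarrow> 'a drury_arveson \<Rightarrow> 'a drury_arveson"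
  where "scaleR_drury_arveson r f = complex_of_real r *\<^sub>C f"

definition cinner_drury_arveson :: "'a drury_arveson \<Rightarrow> 'a drury_arveson \<Rightarrow> complex"
  where "cinner_drury_arveson f g =
    (\<Sum>\<^sub>\<infinity>\<alpha>. of_real (da_weight \<alpha>) * da_coeff f \<alpha> * cnj (da_coeff g \<alpha>))"
definition inner_drury_arveson :: "'a drury_arveson \<Rightarrow> 'a drury_arveson \<Rightarrow> real"
  where "inner_drury_arveson f g = Re (cinner f g)"
definition norm_drury_arveson :: "'a drury_arveson \<Rightarrow> real"
  where "norm_drury_arveson f = sqrt (inner f f)"
definition sgn_drury_arveson :: "'a drury_arveson \<Rightarrow> 'a drury_arveson"
  where "sgn_drury_arveson f = inverse (norm f) *\<^sub>R f"
definition dist_drury_arveson :: "'a drury_arveson \<Rightarrow> 'a drury_arveson \<Rightarrow> real"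
  where "dist_drury_arveson f g = norm (f - g)"
definition uniformity_drury_arveson :: "('a drury_arveson \<times> 'a drury_arveson) filter"
  where "uniformity_drury_arveson = (INF e\<in>{0<..}. principal {(x, y). dist x y < e})"
definition open_drury_arveson :: "'a drury_arveson set \<Rightarrow> bool"
  where "open_drury_arveson U \<longleftrightarrow> (\<forall>x\<in>U. eventually (\<lambda>(x', y). x' = x \<longrightarrow> y \<in> U) uniformity)"

definition da_ell2 :: "'a drury_arveson \<Rightarrow> ('a \<Rightarrow> nat) ell2"
  where "da_ell2 f = Abs_ell2 (\<lambda>\<alpha>. of_real (sqrt (da_weight \<alpha>)) * da_coeff f \<alpha>)"

lemma nth_da_ell2: "ell2_nth (da_ell2 f) \<alpha> = of_real (sqrt (da_weight \<alpha>)) * da_coeff f \<alpha>"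
  unfolding da_ell2_def using da_coeff(2)[of f] by (subst Abs_ell2_inverse) (auto simp: da_summable_iff)

lemma da_coeff_add: "da_coeff (f + g) = (\<lambda>\<alpha>. da_coeff f \<alpha> + da_coeff g \<alpha>)"
  unfolding plus_drury_arveson.rep_eq
  by (rule da_coeff_eqI) (simp add: plus_drury_arveson.rep_eq has_power_series_add da_coeff(1))

lemma da_coeff_scaleC: "da_coeff (a *\<^sub>C f) = (\<lambda>\<alpha>. a * da_coeff f \<alpha>)"
  by (rule da_coeff_eqI) (simp add: scaleC_drury_arveson.rep_eq has_power_series_cmult da_coeff(1))

lemma da_ell2_add: "da_ell2 (f + g) = da_ell2 f + da_ell2 g"
  by (rule ell2_eqI) (simp add: nth_da_ell2 da_coeff_add plus_ell2.rep_eq distrib_left)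

lemma da_ell2_scaleC: "da_ell2 (a *\<^sub>C f) = a *\<^sub>C da_ell2 f"
  by (rule ell2_eqI) (simp add: nth_da_ell2 da_coeff_scaleC scaleC_ell2.rep_eq)

lemma da_ell2_cinner: "cinner (da_ell2 f) (da_ell2 g) = cinner f g"
proof -
  have "complex_of_real (sqrt (da_weight \<alpha>)) * complex_of_real (sqrt (da_weight \<alpha>)) = of_real (da_weight \<alpha>)"
    for \<alpha> :: "'a \<Rightarrow> nat"
    by (simp flip: of_real_mult)
  then have "ell2_nth (da_ell2 f) \<alpha> * cnj (ell2_nth (da_ell2 g) \<alpha>) =
      of_real (da_weight \<alpha>) * da_coeff f \<alpha> * cnj (da_coeff g \<alpha>)" for \<alpha>
    by (simp add: nth_da_ell2)
  then show ?thesis by (simp add: cinner_ell2_def cinner_drury_arveson_def)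
qed

lemma da_eqI:
  assumes "da_coeff f = da_coeff g"
  shows "f = g"
proof -
  have "da_eval f x = da_eval g x" for x
  proof (cases "x \<in> ball 0 1")
    case True
    with da_coeff(1)[of f] da_coeff(1)[of g] show ?thesis
      unfolding has_power_series_def assms using has_sum_unique by blast
  qed (simp add: da_eval_outside)
  then show ?thesis by (metis da_eval_inject ext)
qed

lemma da_ell2_inject: "da_ell2 f = da_ell2 g \<longleftrightarrow> f = g"
proof
  assume "da_ell2 f = da_ell2 g"
  then have "of_real (sqrt (da_weight \<alpha>)) * da_coeff f \<alpha> = of_real (sqrt (da_weight \<alpha>)) * da_coeff g \<alpha>" for \<alpha>
    by (metis nth_da_ell2)
  then have "da_coeff f \<alpha> = da_coeff g \<alpha>" for \<alpha> by simp
  then show "f = g" by (intro da_eqI ext)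
qed simp

lemma da_ell2_surj: "\<exists>f. da_ell2 f = a"
proof -
  define c where "c \<alpha> = ell2_nth a \<alpha> / of_real (sqrt (da_weight \<alpha>))" for \<alpha>
  have a: "ell2_nth a \<alpha> = of_real (sqrt (da_weight \<alpha>)) * c \<alpha>" for \<alpha>
    by (simp add: c_def)
  then have c: "da_summable c"
    using sq_summable_ell2_nth[of a] by (simp add: da_summable_iff flip: a)
  define f where "f x = (if x \<in> ball 0 1 then (\<Sum>\<^sub>\<infinity>\<alpha>. c \<alpha> * multi_power x \<alpha>) else 0)" for x
  have f: "has_power_series f c"
    using da_summable_converges[OF c] by (auto simp: has_power_series_def f_def)
  then have "da_eval (Abs_drury_arveson f) = f"
    using c by (intro Abs_drury_arveson_inverse) (auto simp: f_def)
  then have "da_coeff (Abs_drury_arveson f) = c" using f by (intro da_coeff_eqI) simp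
  then have "da_ell2 (Abs_drury_arveson f) = a" by (intro ell2_eqI) (simp add: nth_da_ell2 a)
  then show ?thesis by blast
qed

lemma da_ell2_zero: "da_ell2 0 = 0"
proof -
  have "0 *\<^sub>C (0 :: 'a drury_arveson) = 0" by transfer simp
  moreover have "0 *\<^sub>C da_ell2 (0 :: 'a drury_arveson) = 0" by (rule ell2_eqI) (simp add: scaleC_ell2.rep_eq zero_ell2.rep_eq)
  ultimately show ?thesis by (metis da_ell2_scaleC)
qed

instance
proof
  fix f g h :: "'a drury_arveson" and a b :: complex and r s :: real
  show "f + g + h = f + (g + h)" by transfer (simp add: add.assoc)
  show "f + g = g + f" by transfer (simp add: add.commute)
  show "0 + f = f" by transfer simp
  show "- f + f = 0" unfolding uminus_drury_arveson_def by transfer simp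
  show "f - g = f + - g" by (rule minus_drury_arveson_def)
  show sc1: "a *\<^sub>C (f + g) = a *\<^sub>C f + a *\<^sub>C g" for a and f g :: "'a drury_arveson"
    by transfer (simp add: algebra_simps)
  show sc2: "(a + b) *\<^sub>C f = a *\<^sub>C f + b *\<^sub>C f" for a b and f :: "'a drury_arveson"
    by transfer (simp add: algebra_simps)
  show sc3: "a *\<^sub>C b *\<^sub>C f = (a * b) *\<^sub>C f" for a b and f :: "'a drury_arveson"
    by transfer (simp add: algebra_simps)
  show sc4: "1 *\<^sub>C f = f" for f :: "'a drury_arveson" by transfer simp
  show "r *\<^sub>R (f + g) = r *\<^sub>R f + r *\<^sub>R g" by (simp add: scaleR_drury_arveson_def sc1)
  show "(r + s) *\<^sub>R f = r *\<^sub>R f + s *\<^sub>R f" by (simp add: scaleR_drury_arveson_def sc2)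
  show "r *\<^sub>R s *\<^sub>R f = (r * s) *\<^sub>R f" by (simp add: scaleR_drury_arveson_def sc3)
  show "1 *\<^sub>R f = f" by (simp add: scaleR_drury_arveson_def sc4)
  show scR: "r *\<^sub>R f = complex_of_real r *\<^sub>C f" for r and f :: "'a drury_arveson"
    by (rule scaleR_drury_arveson_def)
  show "sgn f = inverse (norm f) *\<^sub>R f" by (rule sgn_drury_arveson_def)
  show "dist f g = norm (f - g)" by (rule dist_drury_arveson_def)
  show "uniformity = (INF e\<in>{0<..}. principal {(x :: 'a drury_arveson, y). dist x y < e})"
    by (rule uniformity_drury_arveson_def)
  show "open U = (\<forall>x\<in>U. eventually (\<lambda>(x', y). x' = x \<longrightarrow> y \<in> U) uniformity)" for U :: "'a drury_arveson set"
    by (rule open_drury_arveson_def)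
  show "cinner f g = cnj (cinner g f)"
    unfolding da_ell2_cinner[symmetric] by (rule cinner_commute)
  show "cinner (f + g) h = cinner f h + cinner g h"
    unfolding da_ell2_cinner[symmetric] da_ell2_add by (rule cinner_add_left)
  show "cinner (a *\<^sub>C f) g = a * cinner f g"
    unfolding da_ell2_cinner[symmetric] da_ell2_scaleC by (rule cinner_scaleC_left)
  show "inner f g = Re (cinner f g)" by (rule inner_drury_arveson_def)
  have inn: "inner f g = inner (da_ell2 f) (da_ell2 g)" for f g :: "'a drury_arveson"
    by (simp add: inner_drury_arveson_def inner_eq_Re_cinner da_ell2_cinner)
  show "inner f g = inner g f" unfolding inn by (rule inner_commute)
  show "inner (f + g) h = inner f h + inner g h" unfolding inn da_ell2_add by (rule inner_add_left)
  show "inner (r *\<^sub>R f) g = r * inner f g"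
    unfolding inn scR da_ell2_scaleC scaleR_scaleC[symmetric] by (rule inner_scaleR_left)
  show "0 \<le> inner f f" unfolding inn by simp
  show "norm f = sqrt (inner f f)" by (rule norm_drury_arveson_def)
  show "(inner f f = 0) = (f = 0)"
    unfolding inn inner_eq_zero_iff using da_ell2_inject[of f 0] by (simp add: da_ell2_zero)
qed

end

lemma da_norm_sq: "(norm f)\<^sup>2 = (\<Sum>\<^sub>\<infinity>\<alpha>. da_weight \<alpha> * (cmod (da_coeff f \<alpha>))\<^sup>2)"
proof -
  have "(norm f)\<^sup>2 = (norm (da_ell2 f))\<^sup>2"
    by (simp add: power2_norm_eq_inner inner_eq_Re_cinner da_ell2_cinner)
  also have "\<dots> = (\<Sum>\<^sub>\<infinity>\<alpha>. da_weight \<alpha> * (cmod (da_coeff f \<alpha>))\<^sup>2)"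
    by (simp add: ell2_norm_sq nth_da_ell2 norm_mult power_mult_distrib)
  finally show ?thesis .
qed

lemma da_ell2_dist: "dist (da_ell2 f) (da_ell2 g) = dist f g"
proof -
  have "f - g = f + (-1) *\<^sub>C g" unfolding minus_drury_arveson_def uminus_drury_arveson_def ..
  then have "da_ell2 (f - g) = da_ell2 f + (-1) *\<^sub>C da_ell2 g" by (simp only: da_ell2_add da_ell2_scaleC)
  also have "\<dots> = da_ell2 f - da_ell2 g"
    by (rule ell2_eqI) (simp only: plus_ell2.rep_eq scaleC_ell2.rep_eq minus_ell2.rep_eq, simp)
  finally have *: "da_ell2 (f - g) = da_ell2 f - da_ell2 g" .
  have "norm (da_ell2 h) = norm h" for h :: "'a drury_arveson"
    by (simp add: norm_eq_sqrt_inner inner_eq_Re_cinner da_ell2_cinner)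
  then show ?thesis unfolding dist_norm by (metis *)
qed

instance drury_arveson :: (finite) chilbert_space
proof
  fix X :: "nat \<Rightarrow> 'a drury_arveson" assume "Cauchy X"
  then have "Cauchy (\<lambda>n. da_ell2 (X n))" by (simp add: Cauchy_def da_ell2_dist)
  then obtain a where "(\<lambda>n. da_ell2 (X n)) \<longlonglongrightarrow> a" using Cauchy_convergent convergent_def by blast
  moreover obtain f where "a = da_ell2 f" using da_ell2_surj by metis
  ultimately have "X \<longlonglongrightarrow> f" by (simp add: da_ell2_dist lim_sequentially)
  then show "convergent X" by (auto simp: convergent_def)
qed


subsection \<open>Coordinate multiplications\<close>

lemma has_power_series_coord:
  assumes "has_power_series f c"
  shows "has_power_series (\<lambda>x. x $ k * f x) (\<lambda>\<alpha>. if \<alpha> k = 0 then 0 else c (\<alpha>(k := \<alpha> k - 1)))"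
  unfolding has_power_series_def
proof
  fix x :: "complex ^ 'a" assume "x \<in> ball 0 1"
  let ?c = "\<lambda>\<alpha>. if \<alpha> k = 0 then 0 else c (\<alpha>(k := \<alpha> k - 1))"
  have "((\<lambda>\<alpha>. x $ k * (c \<alpha> * multi_power x \<alpha>)) has_sum x $ k * f x) UNIV"
    using assms \<open>x \<in> ball 0 1\<close> by (auto simp: has_power_series_def intro: has_sum_cmult_right)
  also have "?this \<longleftrightarrow> ((\<lambda>\<alpha>. ?c \<alpha> * multi_power x \<alpha>) has_sum x $ k * f x) {\<alpha>. \<alpha> k \<noteq> 0}"
    by (rule has_sum_reindex_bij_witness[where j = "\<lambda>\<alpha>. \<alpha>(k := Suc (\<alpha> k))" and i = "\<lambda>\<alpha>. \<alpha>(k := \<alpha> k - 1)"])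
       (auto simp: multi_power_upd mult_ac)
  also have "\<dots> \<longleftrightarrow> ((\<lambda>\<alpha>. ?c \<alpha> * multi_power x \<alpha>) has_sum x $ k * f x) UNIV"
    by (rule has_sum_cong_neutral) auto
  finally show "((\<lambda>\<alpha>. ?c \<alpha> * multi_power x \<alpha>) has_sum x $ k * f x) UNIV" .
qed

lemma da_summable_coord:
  fixes c :: "('d::finite \<Rightarrow> nat) \<Rightarrow> complex"
  assumes "da_summable c"
  shows "da_summable (\<lambda>\<alpha>. if \<alpha> k = 0 then 0 else c (\<alpha>(k := \<alpha> k - 1)))"
proof -
  let ?c = "\<lambda>\<alpha>. if \<alpha> k = 0 then 0 else c (\<alpha>(k := \<alpha> k - 1))"
  let ?u = "\<lambda>\<alpha>. \<alpha>(k := Suc (\<alpha> k))"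
  have le: "da_weight (?u \<alpha>) \<le> da_weight \<alpha>" for \<alpha> :: "'d \<Rightarrow> nat"
  proof -
    have "\<alpha> k \<le> multi_deg \<alpha>" unfolding multi_deg_def by (rule member_le_sum) auto
    then have "real (Suc (\<alpha> k)) / real (Suc (multi_deg \<alpha>)) \<le> 1" by simp
    then show ?thesis unfolding da_weight_upd
      by (intro mult_left_le_one_le) auto
  qed
  have "(\<lambda>\<alpha>. da_weight (?u \<alpha>) * (cmod (c \<alpha>))\<^sup>2) summable_on UNIV"
    by (rule summable_on_comparison_test[OF assms[unfolded da_summable_def]])
       (use le in \<open>auto intro!: mult_right_mono\<close>)
  also have "?this \<longleftrightarrow> (\<lambda>\<alpha>. da_weight \<alpha> * (cmod (?c \<alpha>))\<^sup>2) summable_on {\<alpha>. \<alpha> k \<noteq> 0}"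
    by (rule summable_on_reindex_bij_witness[where j = ?u and i = "\<lambda>\<alpha>. \<alpha>(k := \<alpha> k - 1)"]) auto
  also have "\<dots> \<longleftrightarrow> (\<lambda>\<alpha>. da_weight \<alpha> * (cmod (?c \<alpha>))\<^sup>2) summable_on UNIV"
    by (rule summable_on_cong_neutral) auto
  finally show ?thesis by (simp add: da_summable_def)
qed

lift_definition mult_coord :: "'d::finite \<Rightarrow> 'd drury_arveson \<Rightarrow> 'd drury_arveson"
  is "\<lambda>k f x. x $ k * f x"
  using has_power_series_coord da_summable_coord by fastforce

end

theory Submission
  imports Defs
begin

text \<open>
  Let \<open>V\<close> be the minimal isometric dilation of \<open>T\<close> and \<open>M\<close> the closed span of the vectors
  \<open>V\<^sub>w \<xi>\<close> for a cyclic vector \<open>\<xi>\<close>. As \<open>M\<close> is generated by one vector, its wandering subspace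
  \<open>M \<ominus> (V\<^sub>1 M \<oplus> \<dots> \<oplus> V\<^sub>d M)\<close> is spanned by one vector, the component of \<open>\<xi>\<close>, and purity makes this
  vector generate \<open>M\<close>. Its compression \<open>x\<^sub>0\<close> to the space of \<open>T\<close> then yields the operator
  \<open>e\<^sub>w \<mapsto> T\<^sub>w x\<^sub>0\<close>. The dilation itself is not needed: the norm of \<open>p(V) \<xi>\<close> can be
  computed from \<open>T\<close> for every noncommutative polynomial \<open>p\<close>, and \<open>x\<^sub>0\<close> is the limit of \<open>p(T) \<xi>\<close>
  along polynomials with constant term \<open>1\<close> that minimize it. Density of the range
  is the injectivity of the adjoint: if \<open>y\<close> is orthogonal to all \<open>T\<^sub>w x\<^sub>0\<close>, then the functional
  \<open>p(V) \<xi> \<mapsto> \<langle>p(T) \<xi>, y\<rangle>\<close> is controlled by its restriction to polynomials of order at least \<open>N\<close>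
  for all \<open>N\<close>, whose norm tends to \<open>0\<close> by purity. In the commuting case \<open>T\<^sub>w x\<^sub>0\<close> depends
  only on the content of \<open>w\<close>, and summing over words of equal content produces the weights of the
  Drury--Arveson space.
\<close>

section \<open>Complex inner products\<close>

lemma cinner_add_right: "cinner x (y + z) = cinner x y + cinner x z"
  by (metis cinner_add_left cinner_commute complex_cnj_add)

lemma cinner_scaleC_right: "cinner x (c *\<^sub>C y) = cnj c * cinner x y"
  by (metis cinner_commute cinner_scaleC_left complex_cnj_mult)

lemma cinner_zero_left [simp]: "cinner 0 x = 0"
  by (metis cinner_scaleC_left mult_zero_left complex_vector.scale_zero_left)

lemma cinner_zero_right [simp]: "cinner x 0 = 0"
  by (metis cinner_commute cinner_zero_left complex_cnj_zero)

lemma cinner_sum_left: "cinner (\<Sum>i\<in>A. f i) x = (\<Sum>i\<in>A. cinner (f i) x)"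
  by (induction A rule: infinite_finite_induct) (simp_all add: cinner_add_left)

lemma cinner_sum_right: "cinner x (\<Sum>i\<in>A. f i) = (\<Sum>i\<in>A. cinner x (f i))"
  by (induction A rule: infinite_finite_induct) (simp_all add: cinner_add_right)

lemma cinner_self: "cinner x x = complex_of_real ((norm x)\<^sup>2)"
proof -
  have "Im (cinner x x) = 0"
    using cinner_commute[of x x] by (metis complex_cnj cnj.simps(2) equal_neg_zero)
  then show ?thesis
    by (simp add: complex_eq_iff power2_norm_eq_inner inner_eq_Re_cinner)
qed

lemma norm_scaleC: "norm (c *\<^sub>C x) = cmod c * norm x" for x :: "'a::complex_inner"
proof -
  have "complex_of_real ((norm (c *\<^sub>C x))\<^sup>2) = complex_of_real ((cmod c * norm x)\<^sup>2)"
    unfolding cinner_self[symmetric] cinner_scaleC_left cinner_scaleC_right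
    by (simp add: cinner_self power_mult_distrib complex_norm_square[symmetric] flip: of_real_power) (metis complex_norm_square mult.commute of_real_power)
  then have "(norm (c *\<^sub>C x))\<^sup>2 = (cmod c * norm x)\<^sup>2"
    unfolding of_real_eq_iff .
  then show ?thesis by (simp add: power2_eq_iff_nonneg)
qed

lemma cinner_le_norm: "cmod (cinner x y) \<le> norm x * norm y"
proof (cases "cinner x y = 0")
  case False
  let ?c = "cinner x y"
  have "inner (cnj ?c *\<^sub>C x) y = (cmod ?c)\<^sup>2"
    unfolding inner_eq_Re_cinner cinner_scaleC_left cmod_power2
    by (simp add: power2_eq_square)
  moreover have "inner (cnj ?c *\<^sub>C x) y \<le> cmod ?c * norm x * norm y"
    using norm_cauchy_schwarz[of "cnj ?c *\<^sub>C x" y] by (simp add: norm_scaleC)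
  ultimately show ?thesis using False by (simp add: power2_eq_square mult.assoc)
qed simp

lemma cinner_eqI:
  assumes "\<And>x. cinner x y = cinner x z"
  shows "y = z"
proof -
  have "inner x y = inner x z" for x using assms[of x] by (simp add: inner_eq_Re_cinner)
  then show ?thesis by (metis inner_commute vector_eq_rdot)
qed

lemma bounded_linear_scaleC: "bounded_linear (\<lambda>x. c *\<^sub>C x)"
proof (rule bounded_linear_intro[where K = "cmod c"])
  show "c *\<^sub>C (r *\<^sub>R x) = r *\<^sub>R c *\<^sub>C x" for r and x :: 'a
    by (simp add: scaleR_scaleC scaleC_scaleC mult.commute)
qed (simp_all add: scaleC_add_right norm_scaleC mult.commute)

lemma bounded_linear_cinner_left: "bounded_linear (\<lambda>x. cinner x y)"
proof (rule bounded_linear_intro[where K = "norm y"])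
  show "cinner (r *\<^sub>R x) y = r *\<^sub>R cinner x y" for r x
    by (simp add: scaleR_scaleC cinner_scaleC_left scaleR_conv_of_real)
qed (simp_all add: cinner_add_left cinner_le_norm)

lemma bounded_clinearI:
  assumes "\<And>x y. A (x + y) = A x + A y" and "\<And>c x. A (c *\<^sub>C x) = c *\<^sub>C A x"
    and "\<And>x. norm (A x) \<le> norm x * K"
  shows "bounded_clinear A"
  unfolding bounded_clinear_def
  by (intro conjI bounded_linear_intro[where K = K]) (auto simp: assms scaleR_scaleC)

lemma contractiveI:
  assumes "\<And>x y. A (x + y) = A x + A y" and "\<And>c x. A (c *\<^sub>C x) = c *\<^sub>C A x"
    and "\<And>x. norm (A x) \<le> norm x"
  shows "contractive A"
  unfolding contractive_def
  using assms by (auto intro: bounded_clinearI[where K = 1] onorm_bound)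

lemma bounded_clinear_compose:
  "bounded_clinear A \<Longrightarrow> bounded_clinear B \<Longrightarrow> bounded_clinear (\<lambda>x. A (B x))"
  by (simp add: bounded_clinear_def bounded_linear_compose)

lemma cadjoint_compose:
  fixes A :: "'a::chilbert_space \<Rightarrow> 'b::chilbert_space" and B :: "'c::chilbert_space \<Rightarrow> 'a"
  assumes "bounded_clinear A" "bounded_clinear B"
  shows "cadjoint (\<lambda>x. A (B x)) y = cadjoint B (cadjoint A y)"
  by (subst cadjoint_eqI[where B = "\<lambda>y. cadjoint B (cadjoint A y)"])
     (simp_all add: assms cinner_cadjoint)

text \<open>Nearest-point argument: by the parallelogram law a sequence in the range that minimizes
  the distance to \<open>z\<close> is Cauchy, and \<open>z\<close> minus its limit is orthogonal to
  the range.\<close>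

lemma dense_rangeI:
  fixes A :: "'a::complex_inner \<Rightarrow> 'b::chilbert_space"
  assumes A: "bounded_clinear A" and orth: "\<And>y. (\<And>x. cinner (A x) y = 0) \<Longrightarrow> y = 0"
  shows "dense_range A"
proof -
  interpret A: bounded_linear A using A by (simp add: bounded_clinear_def)
  have "z \<in> closure (range A)" for z
  proof -
    define m where "m = Inf (range (\<lambda>x. (norm (z - A x))\<^sup>2))"
    have m_le: "m \<le> (norm (z - A x))\<^sup>2" for x
      unfolding m_def by (rule cInf_lower) (auto intro!: bdd_belowI[of _ 0])
    have "\<exists>x. (norm (z - A x))\<^sup>2 < m + inverse (real (Suc n))" for n
    proof -
      have "Inf (range (\<lambda>x. (norm (z - A x))\<^sup>2)) < m + inverse (real (Suc n))"
        unfolding m_def by simp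
      then show ?thesis
        by (subst (asm) cInf_less_iff) (auto intro!: bdd_belowI[of _ 0])
    qed
    then obtain x where x: "\<And>n. (norm (z - A (x n)))\<^sup>2 < m + inverse (real (Suc n))"
      by metis
    have par: "(dist (A (x i)) (A (x j)))\<^sup>2 \<le> 2 * inverse (real (Suc i)) + 2 * inverse (real (Suc j))"
      for i j
    proof -
      let ?u = "z - A (x i)" and ?v = "z - A (x j)"
      have "z - A ((1/2) *\<^sub>R (x i + x j)) = (1/2) *\<^sub>R (?u + ?v)"
        by (simp add: A.scaleR A.add algebra_simps flip: scaleR_2)
      then have "m \<le> (norm (?u + ?v))\<^sup>2 / 4"
        using m_le[of "(1/2) *\<^sub>R (x i + x j)"] by (simp add: power_divide)
      moreover have "(norm (?u + ?v))\<^sup>2 + (norm (?u - ?v))\<^sup>2 = 2 * (norm ?u)\<^sup>2 + 2 * (norm ?v)\<^sup>2"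
        by (simp only: power2_norm_eq_inner inner_add inner_diff) (simp add: algebra_simps)
      moreover have "dist (A (x i)) (A (x j)) = norm (?u - ?v)"
        by (simp add: dist_norm norm_minus_commute)
      ultimately show ?thesis using x[of i] x[of j] by simp
    qed
    have "Cauchy (\<lambda>n. A (x n))"
    proof (rule metric_CauchyI)
      fix e :: real assume e: "0 < e"
      then obtain N where N: "inverse (real (Suc N)) < e\<^sup>2 / 4"
        using reals_Archimedean[of "e\<^sup>2 / 4"] by auto
      have "dist (A (x i)) (A (x j)) < e" if "i \<ge> N" "j \<ge> N" for i j
      proof -
        have "inverse (real (Suc i)) \<le> inverse (real (Suc N))"
          "inverse (real (Suc j)) \<le> inverse (real (Suc N))"
          using that by (auto intro!: le_imp_inverse_le)
        with par[of i j] N have "(dist (A (x i)) (A (x j)))\<^sup>2 < e\<^sup>2" by linarith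
        then show ?thesis using e by (simp add: power2_less_imp_less)
      qed
      then show "\<exists>M. \<forall>i\<ge>M. \<forall>j\<ge>M. dist (A (x i)) (A (x j)) < e" by blast
    qed
    then obtain s where s: "(\<lambda>n. A (x n)) \<longlonglongrightarrow> s" using Cauchy_convergent convergent_def by blast
    have min: "(norm (z - s))\<^sup>2 \<le> (norm (z - s - A a))\<^sup>2" for a
    proof (rule LIMSEQ_le)
      show "(\<lambda>n. (norm (z - A (x n)))\<^sup>2 - inverse (real (Suc n))) \<longlonglongrightarrow> (norm (z - s))\<^sup>2"
        by (rule tendsto_eq_intros s LIMSEQ_inverse_real_of_nat refl)+ simp
      show "(\<lambda>n. (norm (z - A (x n) - A a))\<^sup>2) \<longlonglongrightarrow> (norm (z - s - A a))\<^sup>2"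
        by (intro tendsto_intros s)
      show "\<exists>N. \<forall>n\<ge>N. (norm (z - A (x n)))\<^sup>2 - inverse (real (Suc n)) \<le> (norm (z - A (x n) - A a))\<^sup>2"
        using x m_le[of "x _ + a"] by (intro exI[of _ 0]) (smt (verit) A.add diff_diff_eq)
    qed
    have "inner (A a) (z - s) = 0" for a
    proof -
      define u where "u = z - s"
      define v where "v = A a"
      have *: "0 \<le> t\<^sup>2 * (norm v)\<^sup>2 - 2 * t * inner v u" for t
      proof -
        have "(norm (u - t *\<^sub>R v))\<^sup>2 = (norm u)\<^sup>2 + (t\<^sup>2 * (norm v)\<^sup>2 - 2 * t * inner v u)"
          unfolding power2_norm_eq_inner
          by (simp add: inner_diff_left inner_diff_right inner_commute[of u v] power2_eq_square right_diff_distrib)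
        then show ?thesis using min[of "t *\<^sub>R a"] by (simp add: A.scaleR u_def v_def)
      qed
      show ?thesis
      proof (cases "v = 0")
        case False
        \<comment> \<open>The quadratic takes its minimum at this argument.\<close>
        from *[of "inner v u / (norm v)\<^sup>2"] False
        have "(inner v u)\<^sup>2 / (norm v)\<^sup>2 \<le> 0"
          by (simp add: power_divide power2_eq_square)
        then have "(inner v u)\<^sup>2 \<le> 0" using False by (simp add: divide_le_0_iff)
        then show ?thesis by (simp add: u_def v_def)
      qed (simp add: u_def v_def)
    qed
    \<comment> \<open>Real orthogonality to the range implies complex orthogonality, because the
      range is stable under multiplication by -\<i>.\<close>
    then have "cinner (A a) (z - s) = 0" for a
      using A unfolding cinner_eq_inner bounded_clinear_def complex_eq_iff
      by (metis complex.sel zero_complex.sel)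
    then have "z = s" using orth[of "z - s"] by simp
    then show ?thesis
      unfolding closure_sequential by (intro exI[of _ "\<lambda>n. A (x n)"]) (simp add: s)
  qed
  then show ?thesis by (auto simp: dense_range_def)
qed

text \<open>\<open>X\<close> is the adjoint of the coefficient map \<open>Y\<close>, which the
  Bessel inequality makes a contraction. Totality is the injectivity of \<open>Y\<close>, hence the
  density of the range of \<open>X\<close>. The last formula says weakly that \<open>X f\<close> is
  the sum of the vectors \<open>ell2_nth f i *\<^sub>C u i\<close>.\<close>

lemma Bessel_synthesis:
  fixes u :: "'i \<Rightarrow> 'h::chilbert_space"
  assumes bessel: "\<And>y F. finite F \<Longrightarrow> (\<Sum>i\<in>F. (cmod (cinner y (u i)))\<^sup>2) \<le> (norm y)\<^sup>2"
    and total: "\<And>y. (\<And>i. cinner y (u i) = 0) \<Longrightarrow> y = 0"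
  obtains X :: "'i ell2 \<Rightarrow> 'h" where "contractive X" "dense_range X"
    "\<And>y f. cinner y (X f) = (\<Sum>\<^sub>\<infinity>i. cinner y (u i) * cnj (ell2_nth f i))"
proof -
  define Y where "Y y = Abs_ell2 (\<lambda>i. cinner y (u i))" for y
  have Y: "ell2_nth (Y y) i = cinner y (u i)" for y i
    unfolding Y_def by (subst Abs_ell2_inverse) (auto intro!: sq_summableI bessel)
  have norm_Y: "norm (Y y) \<le> norm y" for y
    by (rule ell2_norm_leI) (simp_all add: Y bessel)
  have "bounded_clinear Y"
    by (rule bounded_clinearI[where K = 1])
       (simp_all add: norm_Y,
        simp_all add: Y plus_ell2.rep_eq scaleC_ell2.rep_eq cinner_add_left cinner_scaleC_left ell2_eqI)
  then have X: "cinner y (cadjoint Y f) = cinner (Y y) f" for y f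
    by (simp add: cinner_cadjoint)
  have "contractive (cadjoint Y)"
  proof (rule contractiveI)
    fix f :: "'i ell2"
    have "(norm (cadjoint Y f))\<^sup>2 = cmod (cinner (Y (cadjoint Y f)) f)"
      by (metis X cinner_self norm_of_real abs_power2)
    also have "\<dots> \<le> norm (cadjoint Y f) * norm f"
      by (meson cinner_le_norm norm_Y mult_right_mono norm_ge_zero order_trans)
    finally show "norm (cadjoint Y f) \<le> norm f"
      by (metis mult_le_cancel_left_pos norm_ge_zero power2_eq_square zero_less_norm_iff norm_zero)
  qed (rule cinner_eqI, simp add: X cinner_add_right cinner_scaleC_right)+
  moreover have "dense_range (cadjoint Y)"
  proof (rule dense_rangeI)
    show "bounded_clinear (cadjoint Y)"
      using \<open>contractive (cadjoint Y)\<close> by (simp add: contractive_def)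
    fix y assume "\<And>f. cinner (cadjoint Y f) y = 0"
    then have "cinner (Y y) (Y y) = 0" by (metis X cinner_commute complex_cnj_zero)
    then have "Y y = 0" by (simp add: cinner_self)
    then show "y = 0" by (intro total) (metis Y zero_ell2.rep_eq)
  qed
  ultimately show ?thesis
    by (intro that[of "cadjoint Y"]) (simp_all add: X cinner_ell2_def Y)
qed

section \<open>Row contractions\<close>

text \<open>The hypothesis bounds the discriminant: this is Cauchy-Schwarz for a semidefinite form
  known only along a real line. It serves to prove Minkowski's inequality for \<open>excess\<close>
  without constructing a sesquilinear form.\<close>

lemma quadratic_triangle:
  fixes a b c :: real
  assumes "\<And>t. 0 \<le> a + 2 * t * b + t\<^sup>2 * c" "0 \<le> c"
  shows "a + 2 * b + c \<le> (sqrt a + sqrt c)\<^sup>2"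
proof -
  have a: "0 \<le> a" using assms(1)[of 0] by simp
  have "b\<^sup>2 \<le> a * c"
  proof (cases "c = 0")
    case True
    have "b = 0"
    proof (rule ccontr)
      assume "b \<noteq> 0"
      \<comment> \<open>For \<open>c = 0\<close> the expression is affine in t, and at this argument
        it would be -1.\<close>
      then have "2 * (- (a + 1) / (2 * b)) * b = - (a + 1)" by simp
      with assms(1)[of "- (a + 1) / (2 * b)"] True show False by simp
    qed
    then show ?thesis using True by simp
  next
    case False
    with assms have c: "0 < c" by simp
    have "a + 2 * (- b / c) * b + (- b / c)\<^sup>2 * c = a - b\<^sup>2 / c"
      using c by (simp add: power2_eq_square)
    with assms(1)[of "- b / c"] have "b\<^sup>2 / c \<le> a" by linarith
    then show ?thesis using c by (simp add: divide_le_eq)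
  qed
  then have "b \<le> sqrt (a * c)" by (rule real_le_rsqrt)
  then show ?thesis using a assms(2) by (simp add: power2_sum real_sqrt_mult)
qed

section \<open>Finite sums over words\<close>

lemma finite_words: "finite {w :: 'd::finite list. length w = n}"
  using finite_lists_length_eq[of "UNIV :: 'd set" n] by simp

lemma finite_words_less: "finite {w :: 'd::finite list. length w < n}"
  using finite_lists_length_le[of "UNIV :: 'd set" n] by (rule rev_finite_subset) auto

lemma norm_add_scaleR_square:
  "(norm (x + t *\<^sub>R y))\<^sup>2 = (norm x)\<^sup>2 + 2 * t * inner x y + t\<^sup>2 * (norm y)\<^sup>2"
  for x y :: "'a::real_inner"
  unfolding power2_norm_eq_inner
  by (simp add: inner_add_left inner_add_right inner_commute[of y x] power2_eq_square distrib_left)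

lemma sum_words_Suc:
  fixes f :: "'d::finite list \<Rightarrow> 'b::comm_monoid_add"
  shows "(\<Sum>w | length w < Suc n. f w) = f [] + (\<Sum>k\<in>UNIV. \<Sum>w | length w < n. f (k # w))"
proof -
  have eq: "{w :: 'd list. length w < Suc n} = insert [] (\<Union>k. Cons k ` {w. length w < n})"
    by (auto simp: image_iff less_Suc_eq_0_disj length_Suc_conv)
  have "(\<Sum>w | length w < Suc n. f w) = f [] + (\<Sum>w\<in>(\<Union>k. Cons k ` {w. length w < n}). f w)"
    unfolding eq by (subst sum.insert) (auto simp: finite_words_less)
  also have "(\<Sum>w\<in>(\<Union>k. Cons k ` {w. length w < n}). f w) = (\<Sum>k\<in>UNIV. \<Sum>w\<in>Cons k ` {w. length w < n}. f w)"
    by (rule sum.UNION_disjoint) (auto simp: finite_words_less)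
  also have "\<dots> = (\<Sum>k\<in>UNIV. \<Sum>w | length w < n. f (k # w))"
    by (simp add: sum.reindex inj_on_def)
  finally show ?thesis .
qed

lemma sum_words_length_Suc:
  fixes f :: "'d::finite list \<Rightarrow> 'b::comm_monoid_add"
  shows "(\<Sum>w | length w = Suc n. f w) = (\<Sum>k\<in>UNIV. \<Sum>w | length w = n. f (k # w))"
proof -
  have "{w :: 'd list. length w = Suc n} = (\<Union>k. Cons k ` {w. length w = n})"
    by (auto simp: image_iff length_Suc_conv)
  then have "(\<Sum>w | length w = Suc n. f w) = (\<Sum>k\<in>UNIV. \<Sum>w\<in>Cons k ` {w. length w = n}. f w)"
    by (simp only:) (rule sum.UNION_disjoint, auto simp: finite_words)
  then show ?thesis by (simp add: sum.reindex inj_on_def)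
qed

section \<open>Noncommutative polynomials as coefficient functions on words\<close>

lemma word_op_Nil [simp]: "word_op T [] x = x"
  and word_op_Cons [simp]: "word_op T (k # w) x = T k (word_op T w x)"
  by (simp_all add: word_op_def)

text \<open>The adjoint of left creation, on coefficients. A polynomial is \<open>p []\<close> plus
  the sum over k of the letter k times \<open>coshift k p\<close>; the inductions below follow this
  decomposition.\<close>

definition coshift :: "'d \<Rightarrow> ('d list \<Rightarrow> complex) \<Rightarrow> 'd list \<Rightarrow> complex"
  where "coshift k p w = p (k # w)"

text \<open>The bound is strict, so that \<open>degree_less 0\<close> singles out the zero function
  and inductions can start there.\<close>

definition degree_less :: "nat \<Rightarrow> ('d list \<Rightarrow> complex) \<Rightarrow> bool"
  where "degree_less n p \<longleftrightarrow> (\<forall>w. n \<le> length w \<longrightarrow> p w = 0)"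

definition finite_degree :: "('d list \<Rightarrow> complex) \<Rightarrow> bool"
  where "finite_degree p \<longleftrightarrow> (\<exists>n. degree_less n p)"

lemma degree_less_mono: "degree_less n p \<Longrightarrow> n \<le> m \<Longrightarrow> degree_less m p"
  by (simp add: degree_less_def)

lemma degree_less_coshift: "degree_less (Suc n) p \<Longrightarrow> degree_less n (coshift k p)"
  by (simp add: degree_less_def coshift_def)

lemma degree_less_add: "degree_less n p \<Longrightarrow> degree_less n q \<Longrightarrow> degree_less n (\<lambda>w. p w + c * q w)"
  by (simp add: degree_less_def)

lemma coshift_add: "coshift k (\<lambda>w. p w + c * q w) = (\<lambda>w. coshift k p w + c * coshift k q w)"
  by (simp add: coshift_def fun_eq_iff)

lemma coshift_scale: "coshift k (\<lambda>w. c * q w) = (\<lambda>w. c * coshift k q w)"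
  by (simp add: coshift_def fun_eq_iff)

text \<open>The form \<open>Suc n\<close> of the bound leaves room for one
  \<open>coshift\<close>.\<close>

lemma finite_degree_common:
  assumes "finite_degree p" "finite_degree q"
  obtains n where "degree_less (Suc n) p" "degree_less (Suc n) q"
proof -
  obtain a b where "degree_less a p" "degree_less b q" using assms by (auto simp: finite_degree_def)
  then show ?thesis by (intro that[of "max a b"]) (auto elim!: degree_less_mono)
qed

lemma finite_degree_add:
  assumes "finite_degree p" "finite_degree q"
  shows "finite_degree (\<lambda>w. p w + c * q w)"
  by (rule finite_degree_common[OF assms]) (auto simp: finite_degree_def intro: degree_less_add)

lemma finite_degree_scale: "finite_degree p \<Longrightarrow> finite_degree (\<lambda>w. c * p w)"
  by (fastforce simp: finite_degree_def degree_less_def)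

lemma finite_degree_coshift: "finite_degree p \<Longrightarrow> finite_degree (coshift k p)"
  by (rule finite_degree_common[of p p]) (auto simp: finite_degree_def intro: degree_less_coshift)

text \<open>Since the alphabet is finite, the sum of the bounds for all letters is a common
  bound.\<close>

lemma finite_degree_coshiftD:
  fixes p :: "'d::finite list \<Rightarrow> complex"
  assumes "\<And>k. finite_degree (coshift k p)"
  shows "finite_degree p"
proof -
  obtain n where n: "\<And>k. degree_less (n k) (coshift k p)"
    using assms unfolding finite_degree_def by metis
  have "p w = 0" if "Suc (\<Sum>k\<in>UNIV. n k) \<le> length w" for w
  proof (cases w)
    case (Cons k v)
    have "n k \<le> (\<Sum>k\<in>UNIV. n k)" by (rule member_le_sum) auto
    then show ?thesis using that n[of k] Cons by (auto simp: degree_less_def coshift_def)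
  qed (use that in simp)
  then show ?thesis unfolding finite_degree_def degree_less_def by blast
qed

text \<open>The product q p with q cut off below degree \<open>n\<close>: it is \<open>q []\<close>
  times p plus the sum over k of the letter k times the product of \<open>coshift k q\<close> and
  p.\<close>

primrec free_mult :: "nat \<Rightarrow> ('d list \<Rightarrow> complex) \<Rightarrow> ('d list \<Rightarrow> complex) \<Rightarrow> 'd list \<Rightarrow> complex"
  where "free_mult 0 q p = (\<lambda>_. 0)"
  | "free_mult (Suc n) q p =
      (\<lambda>w. (case w of [] \<Rightarrow> 0 | k # v \<Rightarrow> free_mult n (coshift k q) p v) + q [] * p w)"

lemma coshift_case: "coshift k (case_list 0 g) = g k"
  by (simp add: coshift_def fun_eq_iff)

lemma finite_degree_free_mult:
  fixes p :: "'d::finite list \<Rightarrow> complex"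
  assumes "finite_degree p"
  shows "finite_degree (free_mult n q p)"
proof (induction n arbitrary: q)
  case 0
  show ?case by (auto simp: finite_degree_def degree_less_def)
next
  case (Suc n)
  have "finite_degree (case_list 0 (\<lambda>k. free_mult n (coshift k q) p))"
    by (rule finite_degree_coshiftD) (simp add: coshift_case Suc)
  from finite_degree_add[OF this assms] show ?case by simp
qed

section \<open>Evaluation and energy for a row contraction\<close>

locale row_contraction_vector =
  fixes T :: "'d::finite \<Rightarrow> 'h::chilbert_space \<Rightarrow> 'h" and \<xi> :: 'h
  assumes row: "row_contraction T"
begin

lemma bounded_clinear_T: "bounded_clinear (T k)"
  using row by (simp add: row_contraction_def)

lemma bounded_linear_T: "bounded_linear (T k)" and T_scaleC: "T k (c *\<^sub>C x) = c *\<^sub>C T k x"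
  using bounded_clinear_T by (auto simp: bounded_clinear_def)

lemmas T_add = linear_add[OF bounded_linear.linear[OF bounded_linear_T]]
  and T_zero = linear_0[OF bounded_linear.linear[OF bounded_linear_T]]
  and T_sum = linear_sum[OF bounded_linear.linear[OF bounded_linear_T]]

lemma bounded_clinear_word_op: "bounded_clinear (word_op T w)"
proof (induction w)
  case Nil
  show ?case by (rule bounded_clinearI[where K = 1]) (simp_all add: fun_eq_iff)
next
  case (Cons k w)
  from bounded_clinear_compose[OF bounded_clinear_T this, of k] show ?case
    by (simp flip: word_op_Cons)
qed

lemma bounded_linear_word_op: "bounded_linear (word_op T w)"
  using bounded_clinear_word_op by (simp add: bounded_clinear_def)

lemma word_op_scaleC: "word_op T w (c *\<^sub>C x) = c *\<^sub>C word_op T w x"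
  using bounded_clinear_word_op by (simp add: bounded_clinear_def)

lemma cinner_T: "cinner (T k x) y = cinner x (cadjoint (T k) y)"
  by (rule cinner_cadjoint[OF bounded_clinear_T])

lemma sum_norm_adjoint_le: "(\<Sum>k\<in>UNIV. (norm (cadjoint (T k) x))\<^sup>2) \<le> (norm x)\<^sup>2"
proof -
  have "cinner (\<Sum>k\<in>UNIV. T k (cadjoint (T k) x)) x =
      of_real (\<Sum>k\<in>UNIV. (norm (cadjoint (T k) x))\<^sup>2)"
    by (simp add: cinner_sum_left cinner_T cinner_self)
  moreover have "cinner x x = cinner (x - (\<Sum>k\<in>UNIV. T k (cadjoint (T k) x))) x +
      cinner (\<Sum>k\<in>UNIV. T k (cadjoint (T k) x)) x"
    by (simp flip: cinner_add_left)
  moreover have "cinner (x - (\<Sum>k\<in>UNIV. T k (cadjoint (T k) x))) x \<in> \<real>\<^sub>\<ge>\<^sub>0"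
    using row by (simp add: row_contraction_def op_le_def)
  then have "0 \<le> Re (cinner (x - (\<Sum>k\<in>UNIV. T k (cadjoint (T k) x))) x)"
    by (simp add: complex_nonneg_Reals_iff)
  ultimately show ?thesis
    by (metis (no_types, lifting) Re_complex_of_real cinner_self le_add_same_cancel2 plus_complex.sel(1))
qed

text \<open>The adjoint of the row of all \<open>T k\<close> is the column of their adjoints, a
  contraction by \<open>sum_norm_adjoint_le\<close>; so the row is a contraction as well.\<close>

lemma norm_row_le: "(norm (\<Sum>k\<in>UNIV. T k (y k)))\<^sup>2 \<le> (\<Sum>k\<in>UNIV. (norm (y k))\<^sup>2)"
proof -
  define z where "z = (\<Sum>k\<in>UNIV. T k (y k))"
  have "(norm z)\<^sup>2 = Re (cinner z z)" by (simp add: cinner_self)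
  also have "\<dots> = (\<Sum>k\<in>UNIV. inner (y k) (cadjoint (T k) z))"
    by (subst z_def) (simp add: cinner_sum_left cinner_T inner_eq_Re_cinner)
  also have "\<dots> \<le> (\<Sum>k\<in>UNIV. norm (y k) * norm (cadjoint (T k) z))"
    by (intro sum_mono norm_cauchy_schwarz)
  finally have "((norm z)\<^sup>2)\<^sup>2 \<le> (\<Sum>k\<in>UNIV. norm (y k) * norm (cadjoint (T k) z))\<^sup>2"
    by (intro power_mono) simp_all
  also have "\<dots> \<le> (\<Sum>k\<in>UNIV. (norm (y k))\<^sup>2) * (\<Sum>k\<in>UNIV. (norm (cadjoint (T k) z))\<^sup>2)"
    by (rule Cauchy_Schwarz_ineq_sum)
  also have "\<dots> \<le> (\<Sum>k\<in>UNIV. (norm (y k))\<^sup>2) * (norm z)\<^sup>2"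
    by (intro mult_left_mono sum_norm_adjoint_le sum_nonneg) simp
  finally have "(norm z)\<^sup>2 * (norm z)\<^sup>2 \<le> (\<Sum>k\<in>UNIV. (norm (y k))\<^sup>2) * (norm z)\<^sup>2"
    by (simp only: power2_eq_square)
  then have "(norm z)\<^sup>2 \<le> (\<Sum>k\<in>UNIV. (norm (y k))\<^sup>2)"
    by (cases "z = 0") (simp add: sum_nonneg, meson mult_le_cancel_right_pos zero_less_norm_iff zero_less_power)
  then show ?thesis by (simp add: z_def)
qed

text \<open>This is p(T) x cut off below degree \<open>n\<close>. The cut-off keeps the sum finite
  for every \<open>p\<close> and allows recursion on \<open>n\<close>.\<close>

definition eval_upto :: "'h \<Rightarrow> nat \<Rightarrow> ('d list \<Rightarrow> complex) \<Rightarrow> 'h"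
  where "eval_upto x n p = (\<Sum>w | length w < n. p w *\<^sub>C word_op T w x)"

lemma eval_upto_0: "eval_upto x 0 p = 0"
  by (simp add: eval_upto_def)

lemma eval_upto_Suc:
  "eval_upto x (Suc n) p = p [] *\<^sub>C x + (\<Sum>k\<in>UNIV. T k (eval_upto x n (coshift k p)))"
  unfolding eval_upto_def sum_words_Suc by (simp add: T_sum T_scaleC coshift_def)

lemma eval_upto_add:
  "eval_upto x n (\<lambda>w. p w + c * q w) = eval_upto x n p + c *\<^sub>C eval_upto x n q"
  by (simp add: eval_upto_def scaleC_add_left sum.distrib complex_vector.scale_sum_right scaleC_scaleC)

lemma eval_upto_scale: "eval_upto x n (\<lambda>w. c * q w) = c *\<^sub>C eval_upto x n q"
  by (simp add: eval_upto_def complex_vector.scale_sum_right scaleC_scaleC)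

lemma eval_upto_tendsto:
  "(f \<longlongrightarrow> x) F \<Longrightarrow> ((\<lambda>j. eval_upto (f j) n p) \<longlongrightarrow> eval_upto x n p) F"
  unfolding eval_upto_def
  by (intro tendsto_sum bounded_linear.tendsto[OF bounded_linear_scaleC]
      bounded_linear.tendsto[OF bounded_linear_word_op])

text \<open>
  For the minimal isometric dilation \<open>V\<close> of \<open>T\<close>, the energy of \<open>p\<close> is \<open>\<parallel>p(V) \<xi>\<parallel>\<^sup>2\<close>: if \<open>p\<close> has
  no constant term, the orthogonality of the ranges of the \<open>V\<^sub>k\<close> gives the sum over \<open>k\<close>, and
  the mixed terms with the constant term are the same for \<open>V\<close> and \<open>T\<close>.
\<close>

primrec energy_upto :: "nat \<Rightarrow> ('d list \<Rightarrow> complex) \<Rightarrow> real"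
  where "energy_upto 0 p = 0"
  | "energy_upto (Suc n) p = (norm (eval_upto \<xi> (Suc n) p))\<^sup>2
      - (norm (\<Sum>k\<in>UNIV. T k (eval_upto \<xi> n (coshift k p))))\<^sup>2
      + (\<Sum>k\<in>UNIV. energy_upto n (coshift k p))"

text \<open>p(T) \<xi> is the compression of p(V) \<xi>. In terms of \<open>T\<close> alone,
  \<open>norm_row_le\<close> makes the terms that the recursion adds nonnegative.\<close>

lemma norm_eval_upto_le: "(norm (eval_upto \<xi> n p))\<^sup>2 \<le> energy_upto n p"
proof (induction n arbitrary: p)
  case (Suc n)
  have "(norm (\<Sum>k\<in>UNIV. T k (eval_upto \<xi> n (coshift k p))))\<^sup>2 \<le> (\<Sum>k\<in>UNIV. energy_upto n (coshift k p))"
    using norm_row_le sum_mono[OF Suc] by (rule order_trans)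
  then show ?case by simp
qed (simp add: eval_upto_0)

text \<open>Behind the energy stands a hermitian form; its behaviour on real lines is all that
  \<open>quadratic_triangle\<close> asks for.\<close>

lemma energy_upto_quadratic:
  "\<exists>b. \<forall>t::real. energy_upto n (\<lambda>w. p w + of_real t * q w) =
    energy_upto n p + 2 * t * b + t\<^sup>2 * energy_upto n q"
proof (induction n arbitrary: p q)
  case (Suc n)
  define b where "b k = (SOME b. \<forall>t::real. energy_upto n (\<lambda>w. coshift k p w + of_real t * coshift k q w) =
    energy_upto n (coshift k p) + 2 * t * b + t\<^sup>2 * energy_upto n (coshift k q))" for k
  have b: "energy_upto n (\<lambda>w. coshift k p w + of_real t * coshift k q w) =
    energy_upto n (coshift k p) + 2 * t * b k + t\<^sup>2 * energy_upto n (coshift k q)" for k t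
    using someI_ex[OF Suc[of "coshift k p" "coshift k q"]] unfolding b_def by blast
  let ?e = "\<lambda>p. eval_upto \<xi> (Suc n) p" and ?s = "\<lambda>p. \<Sum>k\<in>UNIV. T k (eval_upto \<xi> n (coshift k p))"
  have s: "(\<Sum>k\<in>UNIV. T k (eval_upto \<xi> n (\<lambda>w. coshift k p w + of_real t * coshift k q w))) =
      ?s p + t *\<^sub>R ?s q" for t
    by (simp only: eval_upto_add T_add T_scaleC sum.distrib scaleR_scaleC
        complex_vector.scale_sum_right)
  have e: "?e (\<lambda>w. p w + of_real t * q w) = ?e p + t *\<^sub>R ?e q" for t
    by (simp only: eval_upto_add scaleR_scaleC)
  show ?case
  \<comment> \<open>The cross coefficient is the polarized recursion of
    \<open>energy_upto\<close>.\<close>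
  proof (intro exI allI)
    fix t :: real
    have "(\<Sum>k\<in>UNIV. energy_upto n (\<lambda>w. coshift k p w + of_real t * coshift k q w)) =
        (\<Sum>k\<in>UNIV. energy_upto n (coshift k p)) + 2 * t * (\<Sum>k\<in>UNIV. b k)
        + t\<^sup>2 * (\<Sum>k\<in>UNIV. energy_upto n (coshift k q))"
      by (simp only: b sum.distrib sum_distrib_left)
    then show "energy_upto (Suc n) (\<lambda>w. p w + of_real t * q w) = energy_upto (Suc n) p
        + 2 * t * (inner (?e p) (?e q) - inner (?s p) (?s q) + (\<Sum>k\<in>UNIV. b k))
        + t\<^sup>2 * energy_upto (Suc n) q"
      unfolding energy_upto.simps coshift_add s e norm_add_scaleR_square by (simp add: algebra_simps)
  qed
qed simp

lemma energy_upto_scale: "energy_upto n (\<lambda>w. c * p w) = (cmod c)\<^sup>2 * energy_upto n p"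
proof (induction n arbitrary: p)
  case (Suc n)
  have "(\<Sum>k\<in>UNIV. T k (c *\<^sub>C eval_upto \<xi> n (coshift k p))) =
      c *\<^sub>C (\<Sum>k\<in>UNIV. T k (eval_upto \<xi> n (coshift k p)))"
    by (simp add: T_scaleC complex_vector.scale_sum_right)
  with Suc show ?case
    by (simp add: coshift_scale eval_upto_scale norm_scaleC power_mult_distrib sum_distrib_left[symmetric]
        algebra_simps)
qed simp

lemma zero_upto: "eval_upto x n (\<lambda>_. 0) = 0" "energy_upto n (\<lambda>_. 0) = 0"
  using eval_upto_scale[of x n 0] energy_upto_scale[of n 0] by simp_all

lemma eval_upto_degree_less: "degree_less n p \<Longrightarrow> n \<le> m \<Longrightarrow> eval_upto x m p = eval_upto x n p"
proof (induction n arbitrary: m p)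
  case 0
  then have "p = (\<lambda>_. 0)" by (simp add: degree_less_def fun_eq_iff)
  then show ?case by (simp add: zero_upto)
next
  case (Suc n)
  then obtain m' where m: "m = Suc m'" "n \<le> m'" by (cases m) auto
  then show ?case using Suc.IH[OF degree_less_coshift[OF Suc.prems(1)] m(2)] by (simp add: eval_upto_Suc)
qed

lemma energy_upto_degree_less: "degree_less n p \<Longrightarrow> n \<le> m \<Longrightarrow> energy_upto m p = energy_upto n p"
proof (induction n arbitrary: m p)
  case 0
  then have "p = (\<lambda>_. 0)" by (simp add: degree_less_def fun_eq_iff)
  then show ?case by (simp add: zero_upto)
next
  case (Suc n)
  then obtain m' where m: "m = Suc m'" "n \<le> m'" by (cases m) auto
  then show ?case
    using Suc.IH[OF degree_less_coshift[OF Suc.prems(1)] m(2)]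
      eval_upto_degree_less[OF degree_less_coshift[OF Suc.prems(1)] m(2)]
    by (simp add: eval_upto_Suc)
qed

section \<open>Polynomials of finite degree, without cut-off\<close>

definition nc_eval :: "'h \<Rightarrow> ('d list \<Rightarrow> complex) \<Rightarrow> 'h"
  where "nc_eval x p = eval_upto x (LEAST n. degree_less n p) p"

definition energy :: "('d list \<Rightarrow> complex) \<Rightarrow> real"
  where "energy p = energy_upto (LEAST n. degree_less n p) p"

text \<open>Any degree bound computes the same value, so the least one in \<open>nc_eval\<close> is
  only a canonical choice.\<close>

lemma eval_eq: "degree_less n p \<Longrightarrow> nc_eval x p = eval_upto x n p"
  unfolding nc_eval_def by (rule eval_upto_degree_less[symmetric]) (auto intro: LeastI Least_le)

lemma energy_eq: "degree_less n p \<Longrightarrow> energy p = energy_upto n p"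
  unfolding energy_def by (rule energy_upto_degree_less[symmetric]) (auto intro: LeastI Least_le)

lemma eval_add:
  assumes "finite_degree p" "finite_degree q"
  shows "nc_eval x (\<lambda>w. p w + c * q w) = nc_eval x p + c *\<^sub>C nc_eval x q"
proof -
  obtain n where n: "degree_less (Suc n) p" "degree_less (Suc n) q"
    using assms by (rule finite_degree_common)
  then show ?thesis
    using degree_less_add[OF n] by (simp add: eval_eq[where n = "Suc n"] eval_upto_add)
qed

lemma eval_coshift:
  assumes "finite_degree p"
  shows "nc_eval x p = p [] *\<^sub>C x + (\<Sum>k\<in>UNIV. T k (nc_eval x (coshift k p)))"
proof -
  obtain n where "degree_less (Suc n) p"
    using finite_degree_common[OF assms assms] .
  then show ?thesis
    using degree_less_coshift[of n p]
    by (simp add: eval_eq[where n = "Suc n"] eval_eq[where n = n] eval_upto_Suc)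
qed

lemma energy_coshift:
  assumes "finite_degree p"
  shows "energy p = (norm (nc_eval \<xi> p))\<^sup>2 - (norm (\<Sum>k\<in>UNIV. T k (nc_eval \<xi> (coshift k p))))\<^sup>2
    + (\<Sum>k\<in>UNIV. energy (coshift k p))"
proof -
  obtain n where "degree_less (Suc n) p"
    using finite_degree_common[OF assms assms] .
  then show ?thesis
    using degree_less_coshift[of n p]
    by (simp add: eval_eq[where n = "Suc n"] eval_eq[where n = n] energy_eq[where n = "Suc n"]
        energy_eq[where n = n])
qed

text \<open>Without constant term the two norms in the recursion cancel. For the dilation this is
  the orthogonality of the ranges of the isometries V_k.\<close>

lemma energy_coshift_0:
  assumes "finite_degree p" "p [] = 0"
  shows "energy p = (\<Sum>k\<in>UNIV. energy (coshift k p))"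
  using energy_coshift[OF assms(1)] eval_coshift[OF assms(1), of \<xi>] assms(2) by simp

lemma norm_eval_le:
  assumes "finite_degree p"
  shows "(norm (nc_eval \<xi> p))\<^sup>2 \<le> energy p"
  using assms norm_eval_upto_le unfolding finite_degree_def by (auto simp: eval_eq energy_eq)

lemma energy_nonneg: "finite_degree p \<Longrightarrow> 0 \<le> energy p"
  using norm_eval_le[of p] by (smt (verit) zero_le_power2)

lemma energy_scale:
  assumes "finite_degree p"
  shows "energy (\<lambda>w. c * p w) = (cmod c)\<^sup>2 * energy p"
proof -
  obtain n where "degree_less n p" using assms by (auto simp: finite_degree_def)
  moreover from this have "degree_less n (\<lambda>w. c * p w)" by (simp add: degree_less_def)
  ultimately show ?thesis by (simp add: energy_eq energy_upto_scale)
qed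

lemma energy_quadratic:
  assumes "finite_degree p" "finite_degree q"
  obtains b where "\<And>t::real. energy (\<lambda>w. p w + of_real t * q w) = energy p + 2 * t * b + t\<^sup>2 * energy q"
proof -
  obtain n where n: "degree_less (Suc n) p" "degree_less (Suc n) q"
    using assms by (rule finite_degree_common)
  obtain b where "\<And>t::real. energy_upto (Suc n) (\<lambda>w. p w + of_real t * q w) =
      energy_upto (Suc n) p + 2 * t * b + t\<^sup>2 * energy_upto (Suc n) q"
    using energy_upto_quadratic by blast
  then show ?thesis
    by (intro that) (simp only: energy_eq[OF n(1)] energy_eq[OF n(2)] energy_eq[OF degree_less_add[OF n]])
qed

text \<open>
  The minimal energy is the squared norm of the component of \<open>\<xi>\<close> in the wandering subspace of
  the minimal isometric dilation restricted to its cyclic subspace generated by \<open>\<xi>\<close>; minimizing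
  sequences approximate this component.
\<close>

definition min_energy :: real
  where "min_energy = Inf {energy p | p. finite_degree p \<and> p [] = 1}"

text \<open>The wandering component of p(V) \<xi> is \<open>p []\<close> times that of \<xi>. Hence
  the excess is the squared norm of the remaining component, the one in the span of the V_k
  M.\<close>

definition excess :: "('d list \<Rightarrow> complex) \<Rightarrow> real"
  where "excess p = energy p - min_energy * (cmod (p []))\<^sup>2"

text \<open>The constant 1 is an admissible competitor in the definition of
  \<open>min_energy\<close>.\<close>

lemma vacuum_polynomial:
  defines "p \<equiv> (\<lambda>w. if w = [] then 1 else 0)"
  shows "finite_degree p" "p [] = 1" "energy p = (norm \<xi>)\<^sup>2"
proof -
  have p: "degree_less (Suc 0) p" by (auto simp: degree_less_def p_def)
  then show "finite_degree p" by (auto simp: finite_degree_def)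
  show "energy p = (norm \<xi>)\<^sup>2"
    unfolding energy_eq[OF p] by (simp add: eval_upto_Suc eval_upto_0 T_zero p_def)
  show "p [] = 1" by (simp add: p_def)
qed

lemma min_energy_le: "finite_degree p \<Longrightarrow> p [] = 1 \<Longrightarrow> min_energy \<le> energy p"
  unfolding min_energy_def
  by (rule cInf_lower) (auto intro!: bdd_belowI[of _ 0] energy_nonneg)

lemma min_energy_le_norm: "min_energy \<le> (norm \<xi>)\<^sup>2"
  using min_energy_le[OF vacuum_polynomial(1,2)] unfolding vacuum_polynomial(3) .

lemma min_energy_nonneg: "0 \<le> min_energy"
  unfolding min_energy_def
  using vacuum_polynomial energy_nonneg by (intro cInf_greatest) blast+

text \<open>By homogeneity a nonzero constant term may be scaled to 1; if it is zero, the excess is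
  the energy.\<close>

lemma excess_nonneg:
  assumes "finite_degree p"
  shows "0 \<le> excess p"
proof (cases "p [] = 0")
  case False
  have "min_energy \<le> energy (\<lambda>w. inverse (p []) * p w)"
    using assms False by (intro min_energy_le finite_degree_scale) auto
  also have "\<dots> = energy p / (cmod (p []))\<^sup>2"
    unfolding energy_scale[OF assms]
    by (simp add: norm_inverse power_inverse divide_inverse mult.commute)
  finally show ?thesis using False by (simp add: excess_def le_divide_eq)
qed (simp add: excess_def energy_nonneg assms)

lemma excess_scale:
  assumes "finite_degree p"
  shows "excess (\<lambda>w. c * p w) = (cmod c)\<^sup>2 * excess p"
  using assms by (simp add: excess_def energy_scale norm_mult power_mult_distrib algebra_simps)

lemma excess_le_energy: "excess p \<le> energy p"
  by (simp add: excess_def min_energy_nonneg)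

text \<open>The square root of the excess is a seminorm, as the excess is a nonnegative quadratic
  form.\<close>

lemma excess_triangle:
  assumes p: "finite_degree p" and q: "finite_degree q"
  shows "excess (\<lambda>w. p w + c * q w) \<le> (sqrt (excess p) + cmod c * sqrt (excess q))\<^sup>2"
proof -
  define r where "r w = c * q w" for w
  have r: "finite_degree r" using finite_degree_scale[OF q, of c] by (simp add: r_def[abs_def])
  obtain b where b: "\<And>t::real. energy (\<lambda>w. p w + of_real t * r w) = energy p + 2 * t * b + t\<^sup>2 * energy r"
    using energy_quadratic[OF p r] by blast
  \<comment> \<open>The cross coefficient of the energy, corrected by that of the squared modulus of
    the constant term.\<close>
  define b' where "b' = b - min_energy * inner (p []) (r [])"
  have quad: "excess (\<lambda>w. p w + of_real t * r w) = excess p + 2 * t * b' + t\<^sup>2 * excess r" for t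
    unfolding excess_def b b'_def
    using norm_add_scaleR_square[of "p []" t "r []"]
    by (simp add: scaleR_conv_of_real algebra_simps)
  have "excess (\<lambda>w. p w + c * q w) = excess p + 2 * b' + excess r"
    using quad[of 1] by (simp add: r_def)
  also have "\<dots> \<le> (sqrt (excess p) + sqrt (excess r))\<^sup>2"
  proof (rule quadratic_triangle)
    show "0 \<le> excess p + 2 * t * b' + t\<^sup>2 * excess r" for t
      unfolding quad[symmetric] by (intro excess_nonneg finite_degree_add p r)
  qed (rule excess_nonneg[OF r])
  also have "sqrt (excess r) = cmod c * sqrt (excess q)"
    using excess_scale[OF q, of c] by (simp add: r_def[abs_def] real_sqrt_mult)
  finally show ?thesis .
qed

section \<open>Minimizing sequences and their limit vector\<close>

definition minimizing :: "(nat \<Rightarrow> 'd list \<Rightarrow> complex) \<Rightarrow> bool"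
  where "minimizing P \<longleftrightarrow>
    (\<forall>j. finite_degree (P j) \<and> P j [] = 1) \<and> (\<lambda>j. excess (P j)) \<longlonglongrightarrow> 0"

text \<open>The difference of two polynomials with constant term 1 has none, so its energy equals
  its excess, which \<open>excess_triangle\<close> makes small. The evaluations are therefore
  Cauchy.\<close>

lemma minimizing_exists:
  obtains P x0 where "minimizing P" "(\<lambda>j. nc_eval \<xi> (P j)) \<longlonglongrightarrow> x0"
proof -
  have "\<exists>p. finite_degree p \<and> p [] = 1 \<and> energy p < min_energy + inverse (real (Suc j))" for j
  proof -
    have "Inf {energy p | p. finite_degree p \<and> p [] = 1} < min_energy + inverse (real (Suc j))"
      by (simp add: min_energy_def)
    then show ?thesis
      using vacuum_polynomial
      by (subst (asm) cInf_less_iff) (auto intro!: bdd_belowI[of _ 0] energy_nonneg)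
  qed
  then obtain P where P: "\<And>j. finite_degree (P j)" "\<And>j. P j [] = 1"
    "\<And>j. energy (P j) < min_energy + inverse (real (Suc j))"
    by metis
  have "excess (P j) \<le> inverse (real (Suc j))" for j
    using P(3)[of j] by (simp add: excess_def P(2))
  then have "(\<lambda>j. excess (P j)) \<longlonglongrightarrow> 0"
    by (intro tendsto_sandwich[OF _ _ tendsto_const LIMSEQ_inverse_real_of_nat])
       (auto simp: excess_nonneg P(1))
  moreover from this have lim: "(\<lambda>j. sqrt (excess (P j))) \<longlonglongrightarrow> 0"
    using tendsto_real_sqrt by fastforce
  have dist: "dist (nc_eval \<xi> (P i)) (nc_eval \<xi> (P j)) \<le> sqrt (excess (P i)) + sqrt (excess (P j))" for i j
  proof -
    let ?r = "\<lambda>w. P i w + (-1) * P j w"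
    have "(dist (nc_eval \<xi> (P i)) (nc_eval \<xi> (P j)))\<^sup>2 = (norm (nc_eval \<xi> ?r))\<^sup>2"
      unfolding eval_add[OF P(1) P(1)] by (simp add: dist_norm)
    also have "\<dots> \<le> energy ?r"
      by (intro norm_eval_le finite_degree_add P(1))
    also have "\<dots> = excess ?r" by (simp add: excess_def P(2))
    also have "\<dots> \<le> (sqrt (excess (P i)) + sqrt (excess (P j)))\<^sup>2"
      using excess_triangle[OF P(1) P(1), of i "-1" j] by simp
    finally show ?thesis
      by (rule power2_le_imp_le) (simp add: excess_nonneg P(1))
  qed
  have "Cauchy (\<lambda>j. nc_eval \<xi> (P j))"
  proof (rule metric_CauchyI)
    fix e :: real assume "0 < e"
    then have "\<forall>\<^sub>F j in sequentially. sqrt (excess (P j)) < e / 2"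
      using lim by (intro order_tendstoD) auto
    then obtain N where N: "\<And>j. j \<ge> N \<Longrightarrow> sqrt (excess (P j)) < e / 2"
      by (auto simp: eventually_sequentially)
    have "dist (nc_eval \<xi> (P i)) (nc_eval \<xi> (P j)) < e" if "i \<ge> N" "j \<ge> N" for i j
      using dist[of i j] N[OF that(1)] N[OF that(2)] by linarith
    then show "\<exists>M. \<forall>i\<ge>M. \<forall>j\<ge>M. dist (nc_eval \<xi> (P i)) (nc_eval \<xi> (P j)) < e" by blast
  qed
  then obtain x0 where "(\<lambda>j. nc_eval \<xi> (P j)) \<longlonglongrightarrow> x0"
    using Cauchy_convergent convergent_def by blast
  ultimately show ?thesis using that P by (auto simp: minimizing_def)
qed

text \<open>Evaluation is multiplicative: (q p)(T) x = q(T) (p(T) x), with q cut off.\<close>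

lemma eval_free_mult:
  assumes "finite_degree p"
  shows "nc_eval x (free_mult n q p) = eval_upto (nc_eval x p) n q"
proof (induction n arbitrary: q)
  case 0
  show ?case by (simp add: eval_eq[of 0] degree_less_def eval_upto_0)
next
  case (Suc n)
  let ?s = "case_list 0 (\<lambda>k. free_mult n (coshift k q) p)"
  have s: "finite_degree ?s"
    by (rule finite_degree_coshiftD) (simp add: coshift_case finite_degree_free_mult assms)
  have "nc_eval x (free_mult (Suc n) q p) = nc_eval x ?s + q [] *\<^sub>C nc_eval x p"
    using eval_add[OF s assms] by simp
  also have "nc_eval x ?s = (\<Sum>k\<in>UNIV. T k (eval_upto (nc_eval x p) n (coshift k q)))"
    using eval_coshift[OF s] by (simp add: coshift_case Suc)
  finally show ?case by (simp add: eval_upto_Suc)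
qed

text \<open>In the dilation the \<open>P j\<close> evaluate to vectors tending to the wandering
  component e of \<xi>. The vectors V_w e are orthogonal with squared norm
  \<open>min_energy\<close>, which gives the limit. Carrying only an upper bound \<open>c\<close>
  suffices for the induction.\<close>

lemma energy_free_mult:
  assumes P: "minimizing P"
  shows "\<exists>c. (\<forall>j. energy (free_mult n q (P j)) \<le> c j) \<and>
    c \<longlonglongrightarrow> min_energy * (\<Sum>w | length w < n. (cmod (q w))\<^sup>2)"
proof (induction n arbitrary: q)
  case 0
  show ?case by (intro exI[of _ "\<lambda>_. 0"]) (simp add: energy_eq[of 0] degree_less_def)
next
  case (Suc n)
  have fd: "finite_degree (P j)" "P j [] = 1" for j using P by (auto simp: minimizing_def)
  define S where "S k = (\<Sum>w | length w < n. (cmod (coshift k q w))\<^sup>2)" for k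
  have "\<forall>k. \<exists>c. (\<forall>j. energy (free_mult n (coshift k q) (P j)) \<le> c j) \<and> c \<longlonglongrightarrow> min_energy * S k"
    unfolding S_def using Suc by blast
  then obtain c where c: "\<And>k j. energy (free_mult n (coshift k q) (P j)) \<le> c k j"
    "\<And>k. c k \<longlonglongrightarrow> min_energy * S k"
    by metis
  define C where "C j = min_energy * (cmod (q []))\<^sup>2 +
      (sqrt (\<Sum>k\<in>UNIV. c k j) + cmod (q []) * sqrt (excess (P j)))\<^sup>2" for j
  have "energy (free_mult (Suc n) q (P j)) \<le> C j" for j
  proof -
    let ?s = "case_list 0 (\<lambda>k. free_mult n (coshift k q) (P j))"
    have s: "finite_degree ?s"
      by (rule finite_degree_coshiftD) (simp add: coshift_case finite_degree_free_mult fd)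
    \<comment> \<open>The product has constant term \<open>q []\<close>, because \<open>?s\<close>
      has none and \<open>P j [] = 1\<close>.\<close>
    have "energy (free_mult (Suc n) q (P j)) =
        min_energy * (cmod (q []))\<^sup>2 + excess (\<lambda>w. ?s w + q [] * P j w)"
      by (simp add: excess_def fd)
    also have "excess (\<lambda>w. ?s w + q [] * P j w) \<le> (sqrt (excess ?s) + cmod (q []) * sqrt (excess (P j)))\<^sup>2"
      by (rule excess_triangle[OF s fd(1)])
    also have "\<dots> \<le> (sqrt (\<Sum>k\<in>UNIV. c k j) + cmod (q []) * sqrt (excess (P j)))\<^sup>2"
    proof -
      have "excess ?s \<le> energy ?s" by (rule excess_le_energy)
      also have "\<dots> \<le> (\<Sum>k\<in>UNIV. c k j)"
        using energy_coshift_0[OF s] by (simp add: coshift_case c(1) sum_mono)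
      finally show ?thesis
        using excess_nonneg[OF s] excess_nonneg[OF fd(1)]
        by (intro power_mono add_mono order_refl real_sqrt_le_mono) auto
    qed
    finally show ?thesis by (simp add: C_def)
  qed
  moreover have "C \<longlonglongrightarrow> min_energy * (cmod (q []))\<^sup>2 +
      (sqrt (\<Sum>k\<in>UNIV. min_energy * S k) + cmod (q []) * sqrt 0)\<^sup>2"
    unfolding C_def using P by (intro tendsto_intros c(2)) (auto simp: minimizing_def)
  moreover have "0 \<le> (\<Sum>k\<in>UNIV. min_energy * S k)"
    by (intro sum_nonneg mult_nonneg_nonneg min_energy_nonneg) (simp add: S_def sum_nonneg)
  then have "min_energy * (cmod (q []))\<^sup>2 + (sqrt (\<Sum>k\<in>UNIV. min_energy * S k) + cmod (q []) * sqrt 0)\<^sup>2 =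
      min_energy * (\<Sum>w | length w < Suc n. (cmod (q w))\<^sup>2)"
    unfolding sum_words_Suc by (simp add: S_def coshift_def distrib_left sum_distrib_left)
  ultimately show ?case by auto
qed

text \<open>The energy dominates the norm of q(T) applied to the evaluation of \<open>P j\<close>;
  let j tend to infinity.\<close>

lemma norm_eval_limit_le:
  assumes P: "minimizing P" and x0: "(\<lambda>j. nc_eval \<xi> (P j)) \<longlonglongrightarrow> x0"
  shows "(norm (eval_upto x0 n q))\<^sup>2 \<le> min_energy * (\<Sum>w | length w < n. (cmod (q w))\<^sup>2)"
proof -
  obtain c where c: "\<And>j. energy (free_mult n q (P j)) \<le> c j"
    "c \<longlonglongrightarrow> min_energy * (\<Sum>w | length w < n. (cmod (q w))\<^sup>2)"
    using energy_free_mult[OF P] by blast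
  have "(norm (eval_upto (nc_eval \<xi> (P j)) n q))\<^sup>2 \<le> c j" for j
    using norm_eval_le[of "free_mult n q (P j)"] P c(1)[of j]
    by (simp add: minimizing_def finite_degree_free_mult eval_free_mult)
  then show ?thesis
    using c(2) by (intro LIMSEQ_le[OF tendsto_power[OF tendsto_norm[OF eval_upto_tendsto[OF x0]]]]) auto
qed

text \<open>Duality: \<open>norm_eval_limit_le\<close> bounds the map q -> q(T) \<open>x0\<close>,
  hence its adjoint, with constant \<open>min_energy\<close>, at most 1 by the bound on
  \<xi>.\<close>

lemma Bessel_limit:
  assumes "minimizing P" "(\<lambda>j. nc_eval \<xi> (P j)) \<longlonglongrightarrow> x0" "finite F" "norm \<xi> \<le> 1"
  shows "(\<Sum>w\<in>F. (cmod (cinner y (word_op T w x0)))\<^sup>2) \<le> (norm y)\<^sup>2"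
proof -
  \<comment> \<open>Testing with the coefficients themselves turns the pairing with \<open>y\<close>
    into the sum \<open>S\<close>.\<close>
  define q where "q w = cinner y (word_op T w x0)" for w
  define n where "n = Suc (\<Sum>w\<in>F. length w)"
  define S where "S = (\<Sum>w | length w < n. (cmod (q w))\<^sup>2)"
  have "F \<subseteq> {w. length w < n}"
    using member_le_sum[OF _ _ \<open>finite F\<close>, of _ length] by (auto simp: n_def less_Suc_eq_le)
  then have "(\<Sum>w\<in>F. (cmod (q w))\<^sup>2) \<le> S"
    unfolding S_def using finite_words_less by (intro sum_mono2) auto
  also have "S \<le> (norm y)\<^sup>2"
  proof -
    have S: "0 \<le> S" by (simp add: S_def sum_nonneg)
    have "cinner y (eval_upto x0 n q) = (\<Sum>w | length w < n. cnj (q w) * q w)"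
      by (simp add: eval_upto_def cinner_sum_right cinner_scaleC_right q_def)
    also have "\<dots> = of_real S"
      unfolding S_def of_real_sum by (intro sum.cong refl) (simp only: complex_norm_square mult.commute)
    finally have "S = cmod (cinner y (eval_upto x0 n q))" using S by simp
    also have "\<dots> \<le> norm y * norm (eval_upto x0 n q)" by (rule cinner_le_norm)
    finally have "S\<^sup>2 \<le> (norm y * norm (eval_upto x0 n q))\<^sup>2"
      using S by (intro power_mono)
    also have "\<dots> \<le> (norm y)\<^sup>2 * (min_energy * S)"
      using norm_eval_limit_le[OF assms(1,2), of n q]
      by (simp add: power_mult_distrib mult_left_mono S_def)
    also have "\<dots> \<le> (norm y)\<^sup>2 * (1 * S)"
      using min_energy_le_norm power_mono[OF assms(4), of 2] S
      by (intro mult_left_mono mult_right_mono) auto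
    finally show ?thesis
      using S by (cases "S = 0") (auto simp: power2_eq_square)
  qed
  finally show ?thesis by (simp add: q_def)
qed

section \<open>Vectors orthogonal to the orbit of the limit\<close>

lemma cadjoint_word_op_Cons: "cadjoint (word_op T (k # w)) y = cadjoint (word_op T w) (cadjoint (T k) y)"
  using cadjoint_compose[OF bounded_clinear_T bounded_clinear_word_op, of k w y]
  by (simp flip: word_op_Cons)

text \<open>Subtracting \<open>p []\<close> times \<open>P j\<close> removes the constant term and,
  as \<open>y\<close> is orthogonal to \<open>x0\<close>, leaves the pairing unchanged in the limit.
  The rest is split by first letters, and Cauchy-Schwarz over k combines the induction
  hypotheses.\<close>

lemma orthogonal_limit_bound:
  assumes P: "minimizing P" and x0: "(\<lambda>j. nc_eval \<xi> (P j)) \<longlonglongrightarrow> x0"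
    and "finite_degree p" "\<And>w. cinner (word_op T w x0) y = 0"
  shows "(cmod (cinner (nc_eval \<xi> p) y))\<^sup>2 \<le>
    energy p * (\<Sum>w | length w = N. (norm (cadjoint (word_op T w) y))\<^sup>2)"
  using assms(3,4)
proof (induction N arbitrary: p y)
  case 0
  have "cadjoint (\<lambda>x. x) y = y" for y :: 'h
    by (rule fun_cong[OF cadjoint_eqI[where B = "\<lambda>x. x"]]) simp
  moreover have "(cmod (cinner (nc_eval \<xi> p) y))\<^sup>2 \<le> energy p * (norm y)\<^sup>2"
  proof -
    have "(cmod (cinner (nc_eval \<xi> p) y))\<^sup>2 \<le> (norm (nc_eval \<xi> p) * norm y)\<^sup>2"
      by (intro power_mono cinner_le_norm) simp
    also have "\<dots> \<le> energy p * (norm y)\<^sup>2"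
      by (simp add: power_mult_distrib mult_right_mono norm_eval_le 0)
    finally show ?thesis .
  qed
  ultimately show ?case by simp
next
  case (Suc N)
  have fd: "finite_degree (P j)" "P j [] = 1" for j using P by (auto simp: minimizing_def)
  define \<delta> where "\<delta> y = (\<Sum>w | length w = N. (norm (cadjoint (word_op T w) y))\<^sup>2)" for y
  define r where "r j w = p w + - p [] * P j w" for j w
  have r: "finite_degree (r j)" "r j [] = 0" for j
    using finite_degree_add[OF Suc.prems(1) fd(1), where c = "- p []"] by (auto simp: r_def[abs_def] fd)
  have \<delta>: "(\<Sum>k\<in>UNIV. \<delta> (cadjoint (T k) y)) = (\<Sum>w | length w = Suc N. (norm (cadjoint (word_op T w) y))\<^sup>2)"
    (is "_ = ?\<delta>")
    unfolding sum_words_length_Suc \<delta>_def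
    by (simp add: cadjoint_word_op_Cons)
  have step: "(cmod (cinner (nc_eval \<xi> (r j)) y))\<^sup>2 \<le> energy (r j) * ?\<delta>" for j
  proof -
    have nn: "0 \<le> energy (coshift k (r j))" "0 \<le> \<delta> z" for k z
      by (auto simp: energy_nonneg finite_degree_coshift r \<delta>_def sum_nonneg)
    have IH: "cmod (cinner (nc_eval \<xi> (coshift k (r j))) (cadjoint (T k) y)) \<le>
        sqrt (energy (coshift k (r j))) * sqrt (\<delta> (cadjoint (T k) y))" for k
    proof -
      \<comment> \<open>Orthogonality to the orbit passes to the adjoints, which is why the
        induction varies \<open>y\<close>.\<close>
      have "cinner (word_op T w x0) (cadjoint (T k) y) = 0" for w
        using Suc.prems(2)[of "k # w"] by (simp add: cinner_T)
      then show ?thesis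
        using Suc.IH[of "coshift k (r j)" "cadjoint (T k) y"] r
        by (simp add: finite_degree_coshift \<delta>_def real_le_rsqrt flip: real_sqrt_mult)
    qed
    have "cinner (nc_eval \<xi> (r j)) y = (\<Sum>k\<in>UNIV. cinner (nc_eval \<xi> (coshift k (r j))) (cadjoint (T k) y))"
      using eval_coshift[OF r(1), of \<xi> j] by (simp add: r cinner_sum_left cinner_T)
    then have "cmod (cinner (nc_eval \<xi> (r j)) y) \<le>
        (\<Sum>k\<in>UNIV. sqrt (energy (coshift k (r j))) * sqrt (\<delta> (cadjoint (T k) y)))"
      using IH by (simp add: sum_norm_le)
    then have "(cmod (cinner (nc_eval \<xi> (r j)) y))\<^sup>2 \<le>
        (\<Sum>k\<in>UNIV. sqrt (energy (coshift k (r j))) * sqrt (\<delta> (cadjoint (T k) y)))\<^sup>2"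
      by (rule power_mono) simp
    also have "\<dots> \<le> (\<Sum>k\<in>UNIV. (sqrt (energy (coshift k (r j))))\<^sup>2) * (\<Sum>k\<in>UNIV. (sqrt (\<delta> (cadjoint (T k) y)))\<^sup>2)"
      by (rule Cauchy_Schwarz_ineq_sum)
    also have "\<dots> = energy (r j) * ?\<delta>"
      by (simp add: nn energy_coshift_0[OF r] flip: \<delta>)
    finally show ?thesis .
  qed
  have \<delta>_nonneg: "0 \<le> ?\<delta>" by (simp add: sum_nonneg)
  have "(cmod (cinner (nc_eval \<xi> (r j)) y))\<^sup>2 \<le> (sqrt (excess p) + cmod (p []) * sqrt (excess (P j)))\<^sup>2 * ?\<delta>" for j
  proof -
    have "energy (r j) = excess (r j)" by (simp add: excess_def r)
    also have "\<dots> \<le> (sqrt (excess p) + cmod (p []) * sqrt (excess (P j)))\<^sup>2"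
      using excess_triangle[OF Suc.prems(1) fd(1), of "- p []"] by (simp add: r_def[abs_def])
    finally show ?thesis using step[of j] \<delta>_nonneg by (meson mult_right_mono order_trans)
  qed
  moreover have "(\<lambda>j. (sqrt (excess p) + cmod (p []) * sqrt (excess (P j)))\<^sup>2 * ?\<delta>) \<longlonglongrightarrow>
      (sqrt (excess p) + cmod (p []) * sqrt 0)\<^sup>2 * ?\<delta>"
    using P by (intro tendsto_intros) (auto simp: minimizing_def)
  moreover have "(\<lambda>j. (cmod (cinner (nc_eval \<xi> (r j)) y))\<^sup>2) \<longlonglongrightarrow>
      (cmod (cinner (nc_eval \<xi> p + (- p []) *\<^sub>C x0) y))\<^sup>2"
    unfolding r_def eval_add[OF Suc.prems(1) fd(1)]
    by (intro tendsto_intros x0 bounded_linear.tendsto[OF bounded_linear_cinner_left]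
        bounded_linear.tendsto[OF bounded_linear_scaleC])
  ultimately have "(cmod (cinner (nc_eval \<xi> p + (- p []) *\<^sub>C x0) y))\<^sup>2 \<le>
      (sqrt (excess p) + cmod (p []) * sqrt 0)\<^sup>2 * ?\<delta>"
    by (intro LIMSEQ_le) auto
  moreover have "cinner (nc_eval \<xi> p + (- p []) *\<^sub>C x0) y = cinner (nc_eval \<xi> p) y"
    unfolding cinner_add_left cinner_scaleC_left using Suc.prems(2)[of "[]"] by simp
  moreover have "(sqrt (excess p) + cmod (p []) * sqrt 0)\<^sup>2 * ?\<delta> \<le> energy p * ?\<delta>"
    using excess_nonneg[OF Suc.prems(1)] excess_le_energy \<delta>_nonneg by (simp add: mult_right_mono)
  ultimately show ?case by simp
qed

text \<open>Apply the bound to the monomial w; by purity its right-hand side tends to 0 as N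
  grows.\<close>

lemma orthogonal_limit:
  assumes P: "minimizing P" and x0: "(\<lambda>j. nc_eval \<xi> (P j)) \<longlonglongrightarrow> x0"
    and pure: "pure_tuple T" and y: "\<And>w. cinner (word_op T w x0) y = 0"
  shows "cinner (word_op T w \<xi>) y = 0"
proof -
  define p :: "'d list \<Rightarrow> complex" where "p v = (if v = w then 1 else 0)" for v
  have p: "degree_less (Suc (length w)) p" by (auto simp: degree_less_def p_def)
  have "nc_eval \<xi> p = (\<Sum>v | length v < Suc (length w). if v = w then word_op T w \<xi> else 0)"
    unfolding eval_eq[OF p] eval_upto_def by (rule sum.cong) (auto simp: p_def)
  also have "\<dots> = word_op T w \<xi>" using finite_words_less[where 'd = 'd, of "Suc (length w)"] by simp
  finally have p_eval: "nc_eval \<xi> p = word_op T w \<xi>" .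
  have "(\<lambda>N. energy p * (\<Sum>w | length w = N. (norm (cadjoint (word_op T w) y))\<^sup>2)) \<longlonglongrightarrow> energy p * 0"
    using pure unfolding pure_tuple_def by (intro tendsto_intros) auto
  moreover have "(cmod (cinner (nc_eval \<xi> p) y))\<^sup>2 \<le>
      energy p * (\<Sum>w | length w = N. (norm (cadjoint (word_op T w) y))\<^sup>2)" for N
    using p by (intro orthogonal_limit_bound[OF P x0 _ y]) (auto simp: finite_degree_def)
  ultimately have "(cmod (cinner (nc_eval \<xi> p) y))\<^sup>2 \<le> energy p * 0"
    by (intro LIMSEQ_le_const) auto
  then show ?thesis by (simp add: p_eval)
qed

end

section \<open>From the cyclic vector to a total Bessel orbit\<close>

lemma cinner_eq_0_commute: "cinner x y = 0 \<longleftrightarrow> cinner y x = 0"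
  by (subst cinner_commute) simp

lemma cinner_cadjoint_right:
  fixes A :: "'a::chilbert_space \<Rightarrow> 'b::complex_inner"
  assumes "bounded_clinear A"
  shows "cinner y (A x) = cinner (cadjoint A y) x"
  by (subst (1 2) cinner_commute) (simp add: cinner_cadjoint assms)

lemma total_of_cyclic:
  assumes cyc: "closure (cspan (range (\<lambda>w. word_op T w x))) = UNIV"
    and orth: "\<And>w. cinner (word_op T w x) y = 0"
  shows "y = 0"
proof -
  let ?S = "{z. cinner z y = 0}"
  have "cspan (range (\<lambda>w. word_op T w x)) \<subseteq> ?S"
    unfolding cspan_def
    by (rule complex_vector.span_minimal)
       (auto simp: orth cinner_add_left cinner_scaleC_left intro!: complex_vector.subspaceI)
  moreover have "closed ?S"
    using closed_vimage[OF closed_singleton[of 0], of "\<lambda>z. cinner z y"]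
      linear_continuous_on[OF bounded_linear_cinner_left, of UNIV y]
    by (simp add: vimage_def continuous_on_eq_continuous_at continuous_at_imp_continuous_on)
  ultimately have "y \<in> ?S" using cyc closure_minimal by blast
  then show ?thesis by (simp add: cinner_self)
qed

lemma Bessel_orbit_exists:
  fixes T :: "'d::finite \<Rightarrow> 'h::chilbert_space \<Rightarrow> 'h"
  assumes row: "row_contraction T" and pure: "pure_tuple T" and cyc: "cyclic_tuple T"
  obtains x0 where "\<And>y F. finite F \<Longrightarrow> (\<Sum>w\<in>F. (cmod (cinner y (word_op T w x0)))\<^sup>2) \<le> (norm y)\<^sup>2"
    "\<And>y. (\<And>w. cinner y (word_op T w x0) = 0) \<Longrightarrow> y = 0"
proof -
  obtain x where x: "closure (cspan (range (\<lambda>w. word_op T w x))) = UNIV"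
    using cyc by (auto simp: cyclic_tuple_def)
  \<comment> \<open>Scaling the cyclic vector into the unit ball provides the hypothesis of
    \<open>Bessel_limit\<close>; the added 1 covers \<open>x = 0\<close>.\<close>
  define c where "c = complex_of_real (inverse (norm x + 1))"
  have "0 < norm x + 1" using norm_ge_zero[of x] by linarith
  then have c: "c \<noteq> 0" "norm (c *\<^sub>C x) \<le> 1"
    unfolding c_def norm_scaleC norm_of_real of_real_eq_0_iff by (auto simp: field_simps)
  interpret row_contraction_vector T "c *\<^sub>C x" by standard (rule row)
  obtain P x0 where P: "minimizing P" "(\<lambda>j. nc_eval (c *\<^sub>C x) (P j)) \<longlonglongrightarrow> x0"
    using minimizing_exists .
  show ?thesis
  proof (rule that)
    fix y assume "\<And>w. cinner y (word_op T w x0) = 0"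
    then have "cinner (word_op T w x0) y = 0" for w using cinner_eq_0_commute by blast
    then have "cinner (word_op T w (c *\<^sub>C x)) y = 0" for w
      by (rule orthogonal_limit[OF P pure])
    then have "cinner (word_op T w x) y = 0" for w
      using c(1) by (simp add: word_op_scaleC cinner_scaleC_left)
    then show "y = 0" by (rule total_of_cyclic[OF x])
  qed (rule Bessel_limit[OF P _ c(2)])
qed

section \<open>Words and multi-indices\<close>

definition word_content :: "'d list \<Rightarrow> 'd \<Rightarrow> nat"
  where "word_content w = count (mset w)"

lemma word_content_Cons: "word_content (k # w) = (word_content w)(k := Suc (word_content w k))"
  by (auto simp: word_content_def fun_eq_iff)

lemma word_content_surj: "\<exists>w. word_content w = (\<alpha> :: 'd::finite \<Rightarrow> nat)"
proof -
  have "count (Abs_multiset \<alpha>) = \<alpha>" by (simp add: count_Abs_multiset)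
  then show ?thesis unfolding word_content_def by (metis ex_mset)
qed

lemma word_op_cong_content:
  assumes "commuting_tuple T" "word_content v = word_content w"
  shows "word_op T v = word_op T w"
proof -
  have "mset v = mset w" using assms(2) by (simp add: word_content_def multiset_eqI)
  \<comment> \<open>\<open>foldr\<close> over a word is \<open>fold\<close> over its reversal, which
    has the same multiset of letters.\<close>
  then have "fold T (rev v) = fold T (rev w)"
    using assms(1) by (intro fold_multiset_equiv) (auto simp: commuting_tuple_def)
  then show ?thesis by (simp add: word_op_def foldr_conv_fold)
qed

text \<open>There are \<open>1 / da_weight \<alpha>\<close> words of content \<open>\<alpha>\<close>.\<close>

lemma sum_words_content:
  fixes F :: "('d::finite \<Rightarrow> nat) \<Rightarrow> real"
  shows "(\<Sum>w | length w = n. F (word_content w)) = (\<Sum>\<alpha> | multi_deg \<alpha> = n. F \<alpha> / da_weight \<alpha>)"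
proof (induction n arbitrary: F)
  case 0
  have "{\<alpha> :: 'd \<Rightarrow> nat. multi_deg \<alpha> = 0} = {\<lambda>_. 0}" by (auto simp: multi_deg_def)
  moreover have "word_content ([] :: 'd list) = (\<lambda>_. 0)" by (simp add: word_content_def fun_eq_iff)
  ultimately show ?case by (simp add: da_weight_def multi_fact_def multi_deg_def)
next
  case (Suc n)
  let ?A = "\<lambda>n. {\<alpha> :: 'd \<Rightarrow> nat. multi_deg \<alpha> = n}"
  let ?up = "\<lambda>k \<alpha> :: 'd \<Rightarrow> nat. \<alpha>(k := Suc (\<alpha> k))"
  \<comment> \<open>Of the words with content \<beta>, the fraction \<open>\<beta> k / Suc n\<close>
    begins with k. Over all k these fractions add up to 1.\<close>
  have shift: "(\<Sum>\<alpha>\<in>?A n. F (?up k \<alpha>) / da_weight \<alpha>) =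
      (\<Sum>\<beta>\<in>?A (Suc n). real (\<beta> k) / real (Suc n) * (F \<beta> / da_weight \<beta>))" for k
  proof -
    have "(\<Sum>\<alpha>\<in>?A n. F (?up k \<alpha>) / da_weight \<alpha>) =
        (\<Sum>\<beta>\<in>{\<beta> \<in> ?A (Suc n). \<beta> k \<noteq> 0}. real (\<beta> k) / real (Suc n) * (F \<beta> / da_weight \<beta>))"
    proof (rule sum.reindex_bij_witness[where i = "\<lambda>\<beta>. \<beta>(k := \<beta> k - 1)" and j = "?up k"])
      fix \<beta> assume "\<beta> \<in> {\<beta> \<in> ?A (Suc n). \<beta> k \<noteq> 0}"
      then show "\<beta>(k := \<beta> k - 1) \<in> ?A n"
        using multi_deg_upd[of "\<beta>(k := \<beta> k - 1)" k] by simp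
    next
      fix \<alpha> assume "\<alpha> \<in> ?A n"
      then show "real (?up k \<alpha> k) / real (Suc n) * (F (?up k \<alpha>) / da_weight (?up k \<alpha>)) =
          F (?up k \<alpha>) / da_weight \<alpha>"
        by (simp add: da_weight_upd del: of_nat_Suc)
    qed (auto simp: multi_deg_upd)
    also have "\<dots> = (\<Sum>\<beta>\<in>?A (Suc n). real (\<beta> k) / real (Suc n) * (F \<beta> / da_weight \<beta>))"
      by (rule sum.mono_neutral_left) (auto simp: finite_multi_deg)
    finally show ?thesis .
  qed
  have "(\<Sum>w | length w = Suc n. F (word_content w)) = (\<Sum>k\<in>UNIV. \<Sum>w | length w = n. F (?up k (word_content w)))"
    by (simp add: sum_words_length_Suc word_content_Cons)
  also have "\<dots> = (\<Sum>k\<in>UNIV. \<Sum>\<alpha>\<in>?A n. F (?up k \<alpha>) / da_weight \<alpha>)"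
    using Suc[of "\<lambda>\<alpha>. F (?up k \<alpha>)" for k] by (intro sum.cong) simp_all
  also have "\<dots> = (\<Sum>\<beta>\<in>?A (Suc n). \<Sum>k\<in>UNIV. real (\<beta> k) / real (Suc n) * (F \<beta> / da_weight \<beta>))"
    unfolding shift by (rule sum.swap)
  also have "\<dots> = (\<Sum>\<beta>\<in>?A (Suc n). F \<beta> / da_weight \<beta>)"
  proof (rule sum.cong)
    fix \<beta> assume "\<beta> \<in> ?A (Suc n)"
    then have "real (\<Sum>k\<in>UNIV. \<beta> k) = real (Suc n)" by (simp add: multi_deg_def)
    then show "(\<Sum>k\<in>UNIV. real (\<beta> k) / real (Suc n) * (F \<beta> / da_weight \<beta>)) = F \<beta> / da_weight \<beta>"
      by (simp flip: sum_distrib_right sum_divide_distrib)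
  qed simp
  finally show ?case .
qed

section \<open>The intertwining operators\<close>

text \<open>\<open>X\<close> sends the basis vector of w to \<open>word_op T w x0\<close>, and
  prefixing k to w applies \<open>T k\<close>.\<close>

lemma fock_intertwiner:
  fixes T :: "'d::finite \<Rightarrow> 'h::chilbert_space \<Rightarrow> 'h"
  assumes T: "\<And>k. bounded_clinear (T k)"
    and bessel: "\<And>y F. finite F \<Longrightarrow> (\<Sum>w\<in>F. (cmod (cinner y (word_op T w x0)))\<^sup>2) \<le> (norm y)\<^sup>2"
    and total: "\<And>y. (\<And>w. cinner y (word_op T w x0) = 0) \<Longrightarrow> y = 0"
  shows "\<exists>X :: 'd fock \<Rightarrow> 'h. contractive X \<and> dense_range X \<and>
    (\<forall>k. X \<circ> left_creation k = T k \<circ> X)"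
proof -
  obtain X :: "'d fock \<Rightarrow> 'h" where X: "contractive X" "dense_range X"
    "\<And>y f. cinner y (X f) = (\<Sum>\<^sub>\<infinity>w. cinner y (word_op T w x0) * cnj (ell2_nth f w))"
    by (rule Bessel_synthesis[of "\<lambda>w. word_op T w x0"]) (rule bessel, assumption, rule total, blast+)
  have "X (left_creation k f) = T k (X f)" for k f
  proof (rule cinner_eqI)
    fix y
    have nth: "ell2_nth (left_creation k f) (i # w) = (if i = k then ell2_nth f w else 0)"
      "ell2_nth (left_creation k f) [] = 0" for i w
      by (simp_all add: left_creation_def tensor_left.rep_eq axis_def)
    have "cinner y (X (left_creation k f)) =
        (\<Sum>\<^sub>\<infinity>w\<in>range (Cons k). cinner y (word_op T w x0) * cnj (ell2_nth (left_creation k f) w))"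
      unfolding X(3)
    proof (rule infsum_cong_neutral)
      fix w assume "w \<in> UNIV - range (Cons k)"
      then show "cinner y (word_op T w x0) * cnj (ell2_nth (left_creation k f) w) = 0"
        by (cases w) (auto simp: nth)
    qed auto
    also have "\<dots> = (\<Sum>\<^sub>\<infinity>w. cinner y (T k (word_op T w x0)) * cnj (ell2_nth f w))"
      by (subst infsum_reindex) (simp_all add: o_def nth)
    \<comment> \<open>Move \<open>T k\<close> to the other side and use the formula for
      \<open>X\<close> at \<open>cadjoint (T k) y\<close>.\<close>
    also have "\<dots> = cinner y (T k (X f))"
      by (simp add: cinner_cadjoint_right T X(3))
    finally show "cinner y (X (left_creation k f)) = cinner y (T k (X f))" .
  qed
  then show ?thesis using X by (intro exI[of _ X]) (simp add: fun_eq_iff)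
qed

lemma da_coeff_mult_coord:
  "da_coeff (mult_coord k f) \<alpha> = (if \<alpha> k = 0 then 0 else da_coeff f (\<alpha>(k := \<alpha> k - 1)))"
proof -
  have "da_coeff (mult_coord k f) = (\<lambda>\<alpha>. if \<alpha> k = 0 then 0 else da_coeff f (\<alpha>(k := \<alpha> k - 1)))"
    unfolding mult_coord.rep_eq[abs_def]
    by (rule da_coeff_eqI) (simp add: mult_coord.rep_eq has_power_series_coord da_coeff(1))
  then show ?thesis by simp
qed

text \<open>Each \<alpha> is the content of \<open>1 / da_weight \<alpha>\<close> words, all giving
  the same vector. Grouping them turns the Bessel inequality over words into one over
  multi-indices.\<close>

lemma drury_arveson_intertwiner:
  fixes T :: "'d::finite \<Rightarrow> 'h::chilbert_space \<Rightarrow> 'h"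
  assumes T: "\<And>k. bounded_clinear (T k)" and comm: "commuting_tuple T"
    and bessel: "\<And>y F. finite F \<Longrightarrow> (\<Sum>w\<in>F. (cmod (cinner y (word_op T w x0)))\<^sup>2) \<le> (norm y)\<^sup>2"
    and total: "\<And>y. (\<And>w. cinner y (word_op T w x0) = 0) \<Longrightarrow> y = 0"
  shows "\<exists>X :: 'd drury_arveson \<Rightarrow> 'h. contractive X \<and> dense_range X \<and>
    (\<forall>k. X \<circ> mult_coord k = T k \<circ> X)"
proof -
  \<comment> \<open>By commutativity the choice of the word is immaterial.\<close>
  define v where "v \<alpha> = word_op T (SOME w. word_content w = \<alpha>) x0" for \<alpha>
  have v: "v (word_content w) = word_op T w x0" for w
    unfolding v_def using word_op_cong_content[OF comm someI[of "\<lambda>u. word_content u = word_content w"]] by metis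
  have v_upd: "v (\<alpha>(k := Suc (\<alpha> k))) = T k (v \<alpha>)" for \<alpha> k
    using word_content_surj[of \<alpha>] by (metis word_content_Cons v word_op_Cons)
  \<comment> \<open>The image of the normalized monomial; the monomial \<alpha> itself is to be sent
    to \<open>v \<alpha>\<close>.\<close>
  define u where "u \<alpha> = complex_of_real (1 / sqrt (da_weight \<alpha>)) *\<^sub>C v \<alpha>" for \<alpha>
  have u: "cinner y (u \<alpha>) = cinner y (v \<alpha>) / of_real (sqrt (da_weight \<alpha>))" for y \<alpha>
    by (simp add: u_def cinner_scaleC_right)
  have "(\<Sum>\<alpha>\<in>F. (cmod (cinner y (u \<alpha>)))\<^sup>2) \<le> (norm y)\<^sup>2" if F: "finite F" for y F
  proof -
    define N where "N = Suc (\<Sum>\<alpha>\<in>F. multi_deg \<alpha>)"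
    have sub: "F \<subseteq> (\<Union>n\<in>{..<N}. {\<alpha>. multi_deg \<alpha> = n})"
      using member_le_sum[OF _ _ F, of _ multi_deg] by (auto simp: N_def less_Suc_eq_le)
    have "(\<Sum>\<alpha>\<in>F. (cmod (cinner y (u \<alpha>)))\<^sup>2) \<le>
        (\<Sum>\<alpha>\<in>(\<Union>n\<in>{..<N}. {\<alpha>. multi_deg \<alpha> = n}). (cmod (cinner y (u \<alpha>)))\<^sup>2)"
      using sub by (intro sum_mono2) (auto simp: finite_multi_deg)
    also have "\<dots> = (\<Sum>n<N. \<Sum>\<alpha> | multi_deg \<alpha> = n. (cmod (cinner y (v \<alpha>)))\<^sup>2 / da_weight \<alpha>)"
      by (subst sum.UNION_disjoint) (auto simp: finite_multi_deg u norm_divide power_divide)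
    also have "\<dots> = (\<Sum>n<N. \<Sum>w | length w = n. (cmod (cinner y (word_op T w x0)))\<^sup>2)"
      by (simp add: v flip: sum_words_content)
    also have "\<dots> = (\<Sum>w\<in>(\<Union>n\<in>{..<N}. {w. length w = n}). (cmod (cinner y (word_op T w x0)))\<^sup>2)"
      by (rule sum.UNION_disjoint[symmetric]) (auto simp: finite_words)
    also have "\<dots> \<le> (norm y)\<^sup>2" by (rule bessel) (auto simp: finite_words)
    finally show ?thesis .
  qed
  moreover have "y = 0" if "\<And>\<alpha>. cinner y (u \<alpha>) = 0" for y
  proof (rule total)
    show "cinner y (word_op T w x0) = 0" for w using that[of "word_content w"] by (simp add: u v)
  qed
  ultimately obtain X :: "('d \<Rightarrow> nat) ell2 \<Rightarrow> 'h" where X: "contractive X" "dense_range X"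
    "\<And>y f. cinner y (X f) = (\<Sum>\<^sub>\<infinity>\<alpha>. cinner y (u \<alpha>) * cnj (ell2_nth f \<alpha>))"
    by (rule Bessel_synthesis[of u]) blast+
  define X' where "X' f = X (da_ell2 f)" for f
  have X': "cinner y (X' f) = (\<Sum>\<^sub>\<infinity>\<alpha>. cinner y (v \<alpha>) * cnj (da_coeff f \<alpha>))" for y f
    unfolding X'_def X(3) by (rule infsum_cong) (simp add: u nth_da_ell2)
  have "contractive X'"
  proof (rule contractiveI)
    have norm_X: "norm (X f) \<le> norm f" for f
      using X(1) onorm[of X f] mult_right_mono[of "onorm X" 1 "norm f"]
      by (simp add: contractive_def bounded_clinear_def)
    show "norm (X' f) \<le> norm f" for f
      using norm_X[of "da_ell2 f"]
      by (simp add: X'_def norm_eq_sqrt_inner[of "da_ell2 f"] norm_eq_sqrt_inner[of f]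
          inner_eq_Re_cinner da_ell2_cinner)
  qed (use X(1) in \<open>auto simp: X'_def da_ell2_add da_ell2_scaleC contractive_def bounded_clinear_def
        dest: bounded_linear.linear linear_add\<close>)
  \<comment> \<open>Precomposing with a surjection keeps the range of \<open>X\<close>, and with it
    the density.\<close>
  moreover have "surj (da_ell2 :: 'd drury_arveson \<Rightarrow> _)"
    using da_ell2_surj by (metis surjI)
  then have "range X' = range X"
    by (simp add: X'_def[abs_def] flip: image_image[of X da_ell2])
  with X(2) have "dense_range X'" by (simp add: dense_range_def)
  moreover have "X' (mult_coord k f) = T k (X' f)" for k f
  proof (rule cinner_eqI)
    fix y
    let ?g = "\<lambda>\<alpha>. cinner y (v \<alpha>) * cnj (da_coeff (mult_coord k f) \<alpha>)"
    have "cinner y (X' (mult_coord k f)) = infsum ?g {\<alpha>. \<alpha> k \<noteq> 0}"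
      unfolding X' by (rule infsum_cong_neutral) (auto simp: da_coeff_mult_coord)
    also have "\<dots> = (\<Sum>\<^sub>\<infinity>\<alpha>. cinner y (v (\<alpha>(k := Suc (\<alpha> k)))) * cnj (da_coeff f \<alpha>))"
      by (rule infsum_reindex_bij_witness[where i = "\<lambda>\<alpha>. \<alpha>(k := Suc (\<alpha> k))" and j = "\<lambda>\<alpha>. \<alpha>(k := \<alpha> k - 1)"])
         (auto simp: da_coeff_mult_coord)
    also have "\<dots> = cinner y (T k (X' f))"
      by (simp add: v_upd cinner_cadjoint_right T X')
    finally show "cinner y (X' (mult_coord k f)) = cinner y (T k (X' f))" .
  qed
  ultimately show ?thesis by (intro exI[of _ X']) (simp add: fun_eq_iff)
qed

theorem theorem3p5:
  fixes T :: "'d::finite \<Rightarrow> 'h::chilbert_space \<Rightarrow> 'h"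
  assumes "row_contraction T" and "pure_tuple T" and "cyclic_tuple T"
  shows "(\<exists>X :: 'd fock \<Rightarrow> 'h. contractive X \<and> dense_range X \<and>
            (\<forall>k. X \<circ> left_creation k = T k \<circ> X)) \<and>
         (commuting_tuple T \<longrightarrow>
           (\<exists>X' :: 'd drury_arveson \<Rightarrow> 'h. contractive X' \<and> dense_range X' \<and>
             (\<forall>k. X' \<circ> mult_coord k = T k \<circ> X')))"
proof -
  have T: "bounded_clinear (T k)" for k
    using assms(1) by (simp add: row_contraction_def)
  \<comment> \<open>One vector serves for both operators.\<close>
  obtain x0 where x0:
    "\<And>y F. finite F \<Longrightarrow> (\<Sum>w\<in>F. (cmod (cinner y (word_op T w x0)))\<^sup>2) \<le> (norm y)\<^sup>2"
    "\<And>y. (\<And>w. cinner y (word_op T w x0) = 0) \<Longrightarrow> y = 0"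
    using Bessel_orbit_exists[OF assms] by blast
  show ?thesis
    using fock_intertwiner[of T x0, OF T x0] drury_arveson_intertwiner[of T x0, OF T _ x0] by blast
qed

end
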